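(* Let $d\ge1$ and let $(\mathbf X,Y)$ be a random vector with $\mathbf X=(X_1,\dots,X_d)\in\mathbb R^d$ and $Y\in\{\pm1\}$. Suppose that $\mathbf X$ is purely atomic with finite support, and that for some $N\ge1$, $$\max_{j\in\{1,\dots,d\}}\max_{u\in\mathbb R}\mathbb P(X_j=u)\le\frac1N.$$ Let $\{M_k\}_{k\ge0}$ be the log-odds process constructed from the (entropy) cyclic MinimaxSplit algorithm. Then for every integer $k\ge0$, $$\mathbb E[\log(1+e^{-YM_k})]\le2^{-\lfloor k/d\rfloor/2}\frac{2^k\log(eN)}{N}+\inf_{g\in\mathcal G}\Big(\mathbb E[\log(1+e^{-Yg(\mathbf X)})]+\sqrt{\frac{\log2}{4}}\,2^{-\lfloor k/d\rfloor/2}\Big(\|g\|_{\mathrm{TV}}^{1/2}+\frac{\|g\|_{\mathrm{TV}}}{2}\Big)\Big).$$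
   Context: $\log$ is the natural logarithm. Let $h(p)=-p\log p-(1-p)\log(1-p)$ (with $0\log0=0$), and for $A\subseteq\mathbb R^d$ let $w(A)=\mathbb P(\mathbf X\in A)$ and $\eta_A=\mathbb P(Y=1\mid\mathbf X\in A)$ (with $w(A)h(\eta_A)=0$ if $w(A)=0$). A set $A$ is unsplittable if $w(A)=0$, or if $w(A)>0$ and the conditional law of $Y$ given $\mathbf X\in A$ is a point mass, or if $w(A)>0$ and the conditional law of $\mathbf X$ given $\mathbf X\in A$ is a point mass; otherwise it is splittable. Cyclic MinimaxSplit algorithm (entropy version): nested partitions $\{\pi_k\}_{k\ge0}$ of $\mathbb R^d$ into axis-aligned boxes; $\pi_0=\{\mathbb R^d\}$; given $\pi_k$, put $j=1+(k\bmod d)$; unsplittable $A\in\pi_k$ are kept in $\pi_{k+1}$; each splittable $A\in\pi_k$ is replaced by $A_L=\{\mathbf x\in A:x_j<z\}$ and $A_R=A\setminus A_L$, where the threshold $z$ minimizes $\max\{w(A_L)h(\eta_{A_L}),\,w(A_R)h(\eta_{A_R})\}$ (ties broken arbitrarily). The process is $M_k=\log\big(\eta_A/(1-\eta_A)\big)$ on $\{\mathbf X\in A\}$, $A\in\pi_k$; if $\eta_A\in\{0,1\}$ then $M_k=\mp\infty$ respectively and $\log(1+e^{-YM_k})=0$ on that cell. $\mathcal G$ is the class of additive functions $g(\mathbf x)=g_1(x_1)+\dots+g_d(x_d)$ on $\mathbb R^d$ with each $g_i:\mathbb R\to\mathbb R$ of bounded variation, and $\|g\|_{\mathrm{TV}}$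 is the infimum of $\sum_{i=1}^d\|g_i\|_{\mathrm{TV}}$ over all such additive representations of $g$, where $\|g_i\|_{\mathrm{TV}}$ is the total variation of $g_i$. *)

theory Defs
  imports "HOL-Probability.Probability"
begin

(* The value at 0 and 1 is 0, because ln 0 = 0 here (and 0 * x = 0 in any case). *)
definition binary_entropy :: "real \<Rightarrow> real" where
  "binary_entropy p = - p * ln p - (1 - p) * ln (1 - p)"

definition cell_mass :: "'a measure \<Rightarrow> ('a \<Rightarrow> real ^ 'n) \<Rightarrow> (real ^ 'n) set \<Rightarrow> real" where
  "cell_mass M X A = \<P>(\<omega> in M. X \<omega> \<in> A)"

definition cell_eta ::
  "'a measure \<Rightarrow> ('a \<Rightarrow> real ^ 'n) \<Rightarrow> ('a \<Rightarrow> real) \<Rightarrow> (real ^ 'n) set \<Rightarrow> real" where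
  "cell_eta M X Y A = \<P>(\<omega> in M. Y \<omega> = 1 \<bar> X \<omega> \<in> A)"

(* If the cell has mass 0 then this is 0, whatever the conditional probability is. *)
definition cell_impurity ::
  "'a measure \<Rightarrow> ('a \<Rightarrow> real ^ 'n) \<Rightarrow> ('a \<Rightarrow> real) \<Rightarrow> (real ^ 'n) set \<Rightarrow> real" where
  "cell_impurity M X Y A = cell_mass M X A * binary_entropy (cell_eta M X Y A)"

definition cond_law ::
  "'a measure \<Rightarrow> ('a \<Rightarrow> real ^ 'n) \<Rightarrow> (real ^ 'n) set \<Rightarrow> ('a \<Rightarrow> 'b::topological_space) \<Rightarrow> 'b measure" where
  "cond_law M X A Z = distr (uniform_measure M {\<omega> \<in> space M. X \<omega> \<in> A}) borel Z"

definition point_mass :: "'b::topological_space measure \<Rightarrow> bool" where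
  "point_mass \<mu> \<longleftrightarrow> (\<exists>c. \<mu> = return borel c)"

definition unsplittable ::
  "'a measure \<Rightarrow> ('a \<Rightarrow> real ^ 'n::finite) \<Rightarrow> ('a \<Rightarrow> real) \<Rightarrow> (real ^ 'n) set \<Rightarrow> bool" where
  "unsplittable M X Y A \<longleftrightarrow>
     cell_mass M X A = 0 \<or>
     (cell_mass M X A > 0 \<and> point_mass (cond_law M X A Y)) \<or>
     (cell_mass M X A > 0 \<and> point_mass (cond_law M X A X))"

definition split_left :: "'n \<Rightarrow> real \<Rightarrow> (real ^ 'n) set \<Rightarrow> (real ^ 'n) set" where
  "split_left j z A = {x \<in> A. x $ j < z}"

definition split_right :: "'n \<Rightarrow> real \<Rightarrow> (real ^ 'n) set \<Rightarrow> (real ^ 'n) set" where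
  "split_right j z A = A - split_left j z A"

definition split_objective ::
  "'a measure \<Rightarrow> ('a \<Rightarrow> real ^ 'n) \<Rightarrow> ('a \<Rightarrow> real) \<Rightarrow> 'n \<Rightarrow> (real ^ 'n) set \<Rightarrow> real \<Rightarrow> real" where
  "split_objective M X Y j A z =
     max (cell_impurity M X Y (split_left j z A)) (cell_impurity M X Y (split_right j z A))"

(* "P is a run of the algorithm": a relation rather than a function, since the minimizing
   thresholds z A are arbitrary. The enumeration coord lists the d = CARD('n) coordinates
   as coord 1, ..., coord d. A side of a split may be the empty set, which is then a
   (harmless, unsplittable) member of the later collections. *)
definition cyclic_minimax_split ::
  "'a measure \<Rightarrow> ('a \<Rightarrow> real ^ 'n::finite) \<Rightarrow> ('a \<Rightarrow> real) \<Rightarrow> (nat \<Rightarrow> 'n) \<Rightarrow>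
   (nat \<Rightarrow> (real ^ 'n) set set) \<Rightarrow> bool" where
  "cyclic_minimax_split M X Y coord P \<longleftrightarrow>
     P 0 = {UNIV} \<and>
     (\<forall>k. let j = coord (1 + k mod CARD('n)) in
       \<exists>z. (\<forall>A \<in> P k. \<not> unsplittable M X Y A \<longrightarrow>
              is_arg_min (split_objective M X Y j A) (\<lambda>_. True) (z A)) \<and>
           P (Suc k) =
             (\<Union>A \<in> P k. if unsplittable M X Y A then {A}
                        else {split_left j (z A) A, split_right j (z A) A}))"

definition cell_of :: "'b set set \<Rightarrow> 'b \<Rightarrow> 'b set" where
  "cell_of Q x = (THE A. A \<in> Q \<and> x \<in> A)"

definition log_odds :: "real \<Rightarrow> ereal" where
  "log_odds p = (if p = 0 then -\<infinity> else if p = 1 then \<infinity> else ereal (ln (p / (1 - p))))"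

definition log_odds_process ::
  "'a measure \<Rightarrow> ('a \<Rightarrow> real ^ 'n) \<Rightarrow> ('a \<Rightarrow> real) \<Rightarrow> (nat \<Rightarrow> (real ^ 'n) set set) \<Rightarrow>
   nat \<Rightarrow> 'a \<Rightarrow> ereal" where
  "log_odds_process M X Y P k \<omega> = log_odds (cell_eta M X Y (cell_of (P k) (X \<omega>)))"

(* log (1 + exp (- y m)), with the convention that it is 0 for infinite m. *)
definition logistic_loss :: "real \<Rightarrow> ereal \<Rightarrow> real" where
  "logistic_loss y m = (if \<bar>m\<bar> = \<infinity> then 0 else ln (1 + exp (- y * real_of_ereal m)))"

definition variation_sums :: "(real \<Rightarrow> real) \<Rightarrow> real set" where
  "variation_sums f = {\<Sum>i<n. \<bar>f (t (Suc i)) - f (t i)\<bar> | (n::nat) (t::nat \<Rightarrow> real). mono t}"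

definition bounded_variation :: "(real \<Rightarrow> real) \<Rightarrow> bool" where
  "bounded_variation f \<longleftrightarrow> bdd_above (variation_sums f)"

(* Meaningful for functions of bounded variation only. *)
definition total_variation :: "(real \<Rightarrow> real) \<Rightarrow> real" where
  "total_variation f = Sup (variation_sums f)"

definition additive_reps :: "(real ^ 'n \<Rightarrow> real) \<Rightarrow> ('n::finite \<Rightarrow> real \<Rightarrow> real) set" where
  "additive_reps g =
     {G. (\<forall>i. bounded_variation (G i)) \<and> g = (\<lambda>x. \<Sum>i\<in>UNIV. G i (x $ i))}"

definition additive_bv :: "(real ^ 'n::finite \<Rightarrow> real) set" where
  "additive_bv = {g. additive_reps g \<noteq> {}}"

definition tv_norm :: "(real ^ 'n::finite \<Rightarrow> real) \<Rightarrow> real" where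
  "tv_norm g = (INF G \<in> additive_reps g. \<Sum>i\<in>UNIV. total_variation (G i))"

end

theory Submission
  imports Defs
begin

text \<open>
  The tangent line of the logistic loss at the log-odds of a cell \<open>A\<close> shows that the loss on \<open>A\<close> exceeds
  that of any \<open>g\<close> by at most \<open>w(A) \<eta>\<^sub>A (1 - \<eta>\<^sub>A)\<close> times the oscillation of \<open>g\<close> on \<open>A\<close>, hence by at most
  half the impurity of \<open>A\<close> times this oscillation. Impurity is superadditive, and adding a set of mass
  at most \<open>1/N\<close> increases it by at most \<open>\<epsilon> = 2 ln (eN) / N\<close>; so some threshold, and therefore the minimax one,
  leaves both children with impurity at most \<open>(I(A) + \<epsilon>) / 2\<close>, and after \<open>k\<close> rounds every impurity is at
  most \<open>2\<^sup>-\<^sup>k ln 2 + \<epsilon>\<close>. The oscillations of a component \<open>g\<^sub>j\<close>, summed over all cells, do not increase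
  in a round that splits coordinate \<open>j\<close> and at most double in the others, so they sum to at most
  \<open>\<parallel>g\<parallel> 2\<^sup>k / 2\<^sup>m\<close> with \<open>m = k div d\<close>. Multiplying, the excess risk is at most
  \<open>(ln 2 / 2 + 2\<^sup>k ln (eN) / N) \<parallel>g\<parallel> / 2\<^sup>m\<close>. This and the trivial bound \<open>ln 2\<close> give the claim by AM-GM.
\<close>

section \<open>Weighted entropy\<close>

text \<open>The impurity of a cell as a function of its positive mass \<open>p\<close> and negative mass \<open>q\<close>.\<close>
definition weighted_entropy :: "real \<Rightarrow> real \<Rightarrow> real" where
  "weighted_entropy p q = (p + q) * ln (p + q) - p * ln p - q * ln q"

lemma weighted_entropy_commute: "weighted_entropy p q = weighted_entropy q p"
  by (simp add: weighted_entropy_def add.commute)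

lemma weighted_entropy_0 [simp]: "weighted_entropy 0 q = 0" "weighted_entropy p 0 = 0"
  by (simp_all add: weighted_entropy_def)

text \<open>This is \<open>ln x \<le> x - 1\<close> at \<open>x = s / p\<close>, multiplied by
  \<open>p\<close>. Written with \<open>p * ln p\<close> it also covers
  \<open>p = 0\<close>.\<close>

lemma mult_ln_quotient_le:
  fixes p s :: real
  assumes "p \<ge> 0" "s > 0"
  shows "p * ln s - p * ln p \<le> s - p"
proof (cases "p = 0")
  case False
  then have "p > 0" using assms by simp
  have "ln (s / p) \<le> s / p - 1"
    using ln_le_minus_one[of "s / p"] \<open>p > 0\<close> \<open>s > 0\<close> by simp
  then have "p * ln (s / p) \<le> p * (s / p - 1)"
    using \<open>p > 0\<close> by (intro mult_left_mono) auto
  then show ?thesis using \<open>p > 0\<close> \<open>s > 0\<close> by (simp add: ln_div algebra_simps)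
qed (use assms in simp)

text \<open>Gibbs' inequality: the right side is a cross entropy. The error terms of
  \<open>mult_ln_quotient_le\<close> for \<open>s = (p + q) * r\<close> and
  \<open>s = (p + q) * (1 - r)\<close> sum to zero.\<close>

lemma weighted_entropy_le_cross:
  assumes "p \<ge> 0" "q \<ge> 0" "0 < r" "r < 1"
  shows "weighted_entropy p q \<le> - p * ln r - q * ln (1 - r)"
proof (cases "p + q = 0")
  case True
  then have "p = 0" "q = 0" using assms by auto
  then show ?thesis by simp
next
  case False
  then have s: "p + q > 0" using assms by simp
  have "p * ln ((p + q) * r) - p * ln p \<le> (p + q) * r - p"
    using mult_ln_quotient_le assms s by simp
  moreover have "q * ln ((p + q) * (1 - r)) - q * ln q \<le> (p + q) * (1 - r) - q"
    using mult_ln_quotient_le assms s by simp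
  moreover have "ln ((p + q) * r) = ln (p + q) + ln r" "ln ((p + q) * (1 - r)) = ln (p + q) + ln (1 - r)"
    using assms s by (auto intro!: ln_mult_pos)
  ultimately show ?thesis
    by (simp add: weighted_entropy_def algebra_simps)
qed

text \<open>Equality in Gibbs' inequality at the true proportion: for positive masses
  \<open>weighted_entropy\<close> is a minimum of functions linear in \<open>p\<close> and
  \<open>q\<close>.\<close>

lemma weighted_entropy_eq_cross:
  assumes "p > 0" "q > 0"
  shows "weighted_entropy p q = - p * ln (p / (p + q)) - q * ln (1 - p / (p + q))"
proof -
  have "1 - p / (p + q) = q / (p + q)" using assms by (simp add: field_simps)
  moreover have "ln (p / (p + q)) = ln p - ln (p + q)" "ln (q / (p + q)) = ln q - ln (p + q)"
    using assms by (simp_all add: ln_div)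
  ultimately show ?thesis by (simp only:) (simp add: weighted_entropy_def algebra_simps)
qed

text \<open>A minimum of linear functions is superadditive: take the \<open>r\<close> that is
  optimal for the sum and apply the cross entropy bound to both summands. If a label is absent from
  the sum, all three entropies vanish.\<close>

lemma weighted_entropy_superadditive:
  assumes "p \<ge> 0" "q \<ge> 0" "a \<ge> 0" "b \<ge> 0"
  shows "weighted_entropy p q + weighted_entropy a b \<le> weighted_entropy (p + a) (q + b)"
proof (cases "p + a = 0 \<or> q + b = 0")
  case True
  then have "p = 0 \<and> a = 0 \<or> q = 0 \<and> b = 0" using assms by auto
  then show ?thesis by auto
next
  case False
  define r where "r = (p + a) / (p + a + (q + b))"
  have pos: "p + a > 0" "q + b > 0" using False assms by auto
  have r: "0 < r" "r < 1" using pos by (auto simp: r_def)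
  have "weighted_entropy (p + a) (q + b) = - (p + a) * ln r - (q + b) * ln (1 - r)"
    unfolding r_def using weighted_entropy_eq_cross[OF pos] .
  moreover note weighted_entropy_le_cross[OF assms(1,2) r] weighted_entropy_le_cross[OF assms(3,4) r]
  ultimately show ?thesis by (simp add: algebra_simps)
qed

text \<open>Bounding both logarithms by \<open>ln x \<le> x - 1\<close>, each label contributes at
  least \<open>p * q / (p + q)\<close> to the entropy, whence the factor 1/2.\<close>

lemma gini_le_weighted_entropy:
  assumes "p \<ge> 0" "q \<ge> 0"
  shows "p * q / (p + q) \<le> weighted_entropy p q / 2"
proof (cases "p = 0 \<or> q = 0")
  case False
  then have pos: "p > 0" "q > 0" using assms by auto
  have "p * ln (p / (p + q)) \<le> p * (p / (p + q) - 1)"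
    using ln_le_minus_one[of "p / (p + q)"] pos by (intro mult_left_mono) auto
  moreover have "q * ln (q / (p + q)) \<le> q * (q / (p + q) - 1)"
    using ln_le_minus_one[of "q / (p + q)"] pos by (intro mult_left_mono) auto
  moreover have "p * (p / (p + q) - 1) = - (p * q / (p + q))" "q * (q / (p + q) - 1) = - (p * q / (p + q))"
    using pos by (simp_all add: field_simps)
  moreover have "weighted_entropy p q = - (p * ln (p / (p + q))) - q * ln (q / (p + q))"
    using pos by (simp add: ln_div weighted_entropy_def) (simp add: algebra_simps)
  ultimately show ?thesis by linarith
qed auto

lemma weighted_entropy_nonneg:
  assumes "p \<ge> 0" "q \<ge> 0"
  shows "weighted_entropy p q \<ge> 0"
proof -
  have "p * q / (p + q) \<ge> 0" using assms by simp
  then show ?thesis using gini_le_weighted_entropy[OF assms] by linarith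
qed

lemma weighted_entropy_le_ln_2:
  assumes "p \<ge> 0" "q \<ge> 0" "p + q \<le> 1"
  shows "weighted_entropy p q \<le> ln 2"
proof -
  have "weighted_entropy p q \<le> (p + q) * ln 2"
    using weighted_entropy_le_cross[of p q "1/2"] assms by (simp add: ln_div algebra_simps)
  also have "\<dots> \<le> 1 * ln 2" using assms by (intro mult_right_mono) auto
  finally show ?thesis by simp
qed

text \<open>Of the new terms, \<open>a * ln (p + a + q)\<close> is nonpositive because the total is
  at most 1, raising the total inside \<open>(p + q) * ln (p + q)\<close> costs at most
  \<open>a\<close>, and monotonicity of \<open>ln\<close> leaves \<open>- a * ln a\<close>.\<close>

lemma weighted_entropy_add_left:
  assumes "p \<ge> 0" "q \<ge> 0" "a \<ge> 0" "p + a + q \<le> 1"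
  shows "weighted_entropy (p + a) q \<le> weighted_entropy p q + a * (1 - ln a)"
proof (cases "a = 0")
  case False
  then have a: "a > 0" using assms by simp
  have "p * ln p + a * ln a \<le> p * ln (p + a) + a * ln (p + a)"
  proof (cases "p = 0")
    case False
    then show ?thesis using a assms by (intro add_mono mult_left_mono) auto
  qed (use a in simp)
  moreover have "(p + q) * ln (p + a + q) - (p + q) * ln (p + q) \<le> a"
    using mult_ln_quotient_le[of "p + q" "p + a + q"] a assms by simp
  moreover have "a * ln (p + a + q) \<le> 0"
    using a assms by (intro mult_nonneg_nonpos) auto
  ultimately show ?thesis
    by (simp add: weighted_entropy_def algebra_simps)
qed simp

text \<open>The function \<open>x * (1 - ln x)\<close> has derivative \<open>- ln x\<close>,
  nonnegative up to 1. The argument avoids derivatives and so includes \<open>a = 0\<close>.\<close>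

lemma entropy_increment_mono:
  fixes a c :: real
  assumes "0 \<le> a" "a \<le> c" "c \<le> 1" "0 < c"
  shows "a * (1 - ln a) \<le> c * (1 - ln c)"
proof -
  have "a * ln c - a * ln a \<le> c - a" using mult_ln_quotient_le assms by simp
  moreover have "(c - a) * ln c \<le> 0" using assms by (intro mult_nonneg_nonpos) auto
  ultimately show ?thesis by (simp add: algebra_simps)
qed

text \<open>The two labels are added one after the other, each at a cost of at most
  \<open>c * (1 - ln c)\<close>. For \<open>c = 1 / N\<close> the total is the error
  \<open>2 * ln (exp 1 * N) / N\<close>.\<close>

lemma weighted_entropy_increment:
  assumes "p \<ge> 0" "q \<ge> 0" "a \<ge> 0" "b \<ge> 0" "p + a + (q + b) \<le> 1"
    and "a + b \<le> c" "0 < c" "c \<le> 1"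
  shows "weighted_entropy (p + a) (q + b) \<le> weighted_entropy p q + 2 * (c * (1 - ln c))"
proof -
  have "weighted_entropy (p + a) (q + b) \<le> weighted_entropy p (q + b) + a * (1 - ln a)"
    using assms by (intro weighted_entropy_add_left) auto
  moreover have "weighted_entropy (q + b) p \<le> weighted_entropy q p + b * (1 - ln b)"
    using assms by (intro weighted_entropy_add_left) auto
  moreover have "a * (1 - ln a) \<le> c * (1 - ln c)" "b * (1 - ln b) \<le> c * (1 - ln c)"
    using assms by (auto intro: entropy_increment_mono)
  ultimately show ?thesis
    using weighted_entropy_commute[of p "q + b"] weighted_entropy_commute[of q p] by linarith
qed

section \<open>Logistic loss at the log-odds\<close>

text \<open>The convex function \<open>ln (1 + exp (- t))\<close> lies above its tangent at
  \<open>t = ln (r / (1 - r))\<close>, where its value is \<open>- ln r\<close> and its slope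
  \<open>- (1 - r)\<close>.\<close>

lemma logistic_tangent:
  fixes r t :: real
  assumes "0 < r" "r < 1"
  shows "- ln r \<le> ln (1 + exp (- t)) + (1 - r) * (t - ln (r / (1 - r)))"
proof -
  define s where "s = ln (r / (1 - r)) - t"
  \<comment> \<open>The linear terms of these two bounds cancel in the sum, which after
    multiplication by \<open>exp ((1 - r) * s)\<close> gives the weighted AM-GM inequality
    \<open>exp ((1 - r) * s) \<le> r + (1 - r) * exp s\<close>. This is the exponentiated
    claim.\<close>
  have "r * (1 + - ((1 - r) * s)) \<le> r * exp (- ((1 - r) * s))"
    using assms exp_ge_add_one_self[of "- ((1 - r) * s)"] by (intro mult_left_mono) auto
  moreover have "(1 - r) * (1 + r * s) \<le> (1 - r) * exp (r * s)"
    using assms exp_ge_add_one_self[of "r * s"] by (intro mult_left_mono) auto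
  moreover have "r * (1 + - ((1 - r) * s)) + (1 - r) * (1 + r * s) = 1" by (simp add: algebra_simps)
  ultimately have "exp ((1 - r) * s) * 1 \<le> exp ((1 - r) * s) * (r * exp (- ((1 - r) * s)) + (1 - r) * exp (r * s))"
    by (intro mult_left_mono) (linarith, simp)
  also have "\<dots> = r * (exp ((1 - r) * s) * exp (- ((1 - r) * s))) + (1 - r) * (exp ((1 - r) * s) * exp (r * s))"
    by (simp add: algebra_simps)
  also have "\<dots> = r + (1 - r) * exp s"
    by (simp add: mult_exp_exp algebra_simps)
  also have "exp s = r / (1 - r) * exp (- t)"
    using assms by (simp add: s_def exp_diff exp_minus divide_inverse)
  also have "r + (1 - r) * (r / (1 - r) * exp (- t)) = r * (1 + exp (- t))"
    using assms by (simp add: distrib_left)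
  finally have "ln (exp ((1 - r) * s)) \<le> ln (r * (1 + exp (- t)))"
    using assms by (subst ln_le_cancel_iff) (auto intro!: mult_pos_pos add_pos_pos)
  also have "\<dots> = ln r + ln (1 + exp (- t))"
    using assms by (intro ln_mult_pos) (auto intro: add_pos_pos)
  finally show ?thesis by (simp add: s_def algebra_simps)
qed

lemma logistic_loss_nonneg: "logistic_loss y m \<ge> 0"
  by (simp add: logistic_loss_def)

lemma logistic_loss_log_odds:
  assumes "0 < r" "r < 1"
  shows "logistic_loss 1 (log_odds r) = - ln r" "logistic_loss (- 1) (log_odds r) = - ln (1 - r)"
proof -
  have "1 + exp (- ln (r / (1 - r))) = 1 / r"
    using assms by (simp add: exp_minus field_simps)
  then show "logistic_loss 1 (log_odds r) = - ln r"
    using assms by (simp add: logistic_loss_def log_odds_def ln_div)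
  have "1 + exp (ln (r / (1 - r))) = 1 / (1 - r)"
    using assms by (simp add: field_simps)
  then show "logistic_loss (- 1) (log_odds r) = - ln (1 - r)"
    using assms by (simp add: logistic_loss_def log_odds_def ln_div)
qed

text \<open>The additive constants are the slopes of the tangent lines at the log-odds of the cell; their
  contributions at the log-odds itself cancel, which leaves only the oscillation \<open>b\<close>.\<close>
lemma cell_excess_loss:
  assumes "p \<ge> 0" "q \<ge> 0" "b \<ge> 0"
  shows "\<exists>\<alpha> \<beta>. \<alpha> * p + \<beta> * q \<le> weighted_entropy p q / 2 * b \<and>
    (\<forall>t. c \<le> t \<and> t \<le> c + b \<longrightarrow>
       logistic_loss 1 (log_odds (p / (p + q))) \<le> ln (1 + exp (- t)) + \<alpha> \<and>
       logistic_loss (- 1) (log_odds (p / (p + q))) \<le> ln (1 + exp t) + \<beta>)"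
proof (cases "p = 0 \<or> q = 0")
  case True
  \<comment> \<open>A cell of mass 0 belongs here too: \<open>0 / 0 = 0\<close> makes its log-odds
    infinite and its loss 0.\<close>
  then have "\<bar>log_odds (p / (p + q))\<bar> = \<infinity>" by (auto simp: log_odds_def)
  then have "logistic_loss y (log_odds (p / (p + q))) = 0" for y
    by (simp add: logistic_loss_def)
  with True show ?thesis by (intro exI[of _ 0]) auto
next
  case False
  then have pos: "p > 0" "q > 0" using assms by auto
  define r where "r = p / (p + q)"
  define m where "m = ln (r / (1 - r))"
  have r: "0 < r" "r < 1" using pos by (auto simp: r_def)
  have r1: "1 - r = q / (p + q)" using pos by (simp add: r_def field_simps)
  have m': "ln ((1 - r) / r) = - m" using r by (simp add: m_def ln_div)
  \<comment> \<open>Each tangent correction is taken at its worst end of the interval,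
    \<open>c + b\<close> for label 1 and \<open>c\<close> for label -1. The weights
    \<open>(1 - r) * p\<close> and \<open>r * q\<close> are equal.\<close>
  have "(1 - r) * (c + b - m) * p + r * (m - c) * q = p * q / (p + q) * b"
  proof -
    have "(1 - r) * p = p * q / (p + q)" "r * q = p * q / (p + q)"
      by (simp_all add: r1) (simp add: r_def)
    moreover have "(1 - r) * (c + b - m) * p + r * (m - c) * q = (1 - r) * p * (c + b - m) + r * q * (m - c)"
      by simp
    moreover have "G * (c + b - m) + G * (m - c) = G * b" for G
      by (simp add: algebra_simps)
    ultimately show ?thesis by (simp only:)
  qed
  also have "\<dots> \<le> weighted_entropy p q / 2 * b"
    using gini_le_weighted_entropy assms by (intro mult_right_mono) auto
  finally have "(1 - r) * (c + b - m) * p + r * (m - c) * q \<le> weighted_entropy p q / 2 * b" .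
  moreover have "- ln r \<le> ln (1 + exp (- t)) + (1 - r) * (c + b - m)" if "t \<le> c + b" for t
  proof -
    have "(1 - r) * (t - m) \<le> (1 - r) * (c + b - m)" using that r by (intro mult_left_mono) auto
    then show ?thesis using logistic_tangent[OF r, of t] by (simp add: m_def)
  qed
  moreover have "- ln (1 - r) \<le> ln (1 + exp t) + r * (m - c)" if "c \<le> t" for t
  proof -
    have "r * (m - t) \<le> r * (m - c)" using that r by (intro mult_left_mono) auto
    moreover have "- ln (1 - r) \<le> ln (1 + exp t) + r * (m - t)"
      using logistic_tangent[of "1 - r" "- t"] r m' by simp
    ultimately show ?thesis by linarith
  qed
  ultimately show ?thesis
    using r unfolding r_def[symmetric]
    by (intro exI[of _ "(1 - r) * (c + b - m)"] exI[of _ "r * (m - c)"])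
       (simp add: logistic_loss_log_odds)
qed

section \<open>Bounded variation and oscillation\<close>

text \<open>The variation function of the Jordan decomposition: \<open>v x\<close> is the variation
  of \<open>f\<close> on the half-line up to \<open>x\<close>.\<close>

lemma bounded_variation_dominating_mono:
  assumes "bounded_variation f"
  obtains v where "mono v" "\<And>x. 0 \<le> v x" "\<And>x. v x \<le> total_variation f"
    "\<And>x y. x \<le> y \<Longrightarrow> \<bar>f y - f x\<bar> \<le> v y - v x"
proof -
  define S where "S x = {\<Sum>i<n. \<bar>f (t (Suc i)) - f (t i)\<bar> | (n::nat) (t::nat \<Rightarrow> real).
    mono t \<and> (\<forall>i. t i \<le> x)}" for x
  define v where "v x = Sup (S x)" for x
  have sub: "S x \<subseteq> variation_sums f" for x by (auto simp: S_def variation_sums_def)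
  have bdd: "bdd_above (variation_sums f)" using assms by (simp add: bounded_variation_def)
  have bddS: "bdd_above (S x)" for x using bdd_above_mono[OF bdd sub] .
  have zero: "0 \<in> S x" for x
  proof -
    have "(\<Sum>i<(0::nat). \<bar>f ((\<lambda>_. x) (Suc i)) - f ((\<lambda>_. x) i)\<bar>) \<in> S x"
      unfolding S_def by (rule CollectI, intro exI conjI) (auto simp: mono_def)
    then show ?thesis by simp
  qed
  have step: "\<bar>f y - f x\<bar> \<le> v y - v x" if "x \<le> y" for x y
  proof -
    have "s \<le> v y - \<bar>f y - f x\<bar>" if "s \<in> S x" for s
    proof -
      from that obtain n t where s: "s = (\<Sum>i<n. \<bar>f (t (Suc i)) - f (t i)\<bar>)"
        and t: "mono t" "\<And>i. t i \<le> x" by (auto simp: S_def)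
      \<comment> \<open>The chain is cut off at index \<open>n\<close> and continued by
        \<open>x\<close> and then \<open>y\<close>. The step from \<open>t n\<close> to
        \<open>x\<close> adds a nonnegative term, the step from \<open>x\<close> to \<open>y\<close>
        the wanted increment.\<close>
      define t' where "t' i = (if i \<le> n then t i else if i = Suc n then x else y)" for i
      have "mono t'"
        unfolding mono_def t'_def using t \<open>x \<le> y\<close> order_trans[OF t(2) \<open>x \<le> y\<close>]
        by (auto dest: monoD)
      moreover have "\<forall>i. t' i \<le> y"
        using order_trans[OF t(2) \<open>x \<le> y\<close>] \<open>x \<le> y\<close> by (auto simp: t'_def)
      ultimately have "(\<Sum>i<Suc (Suc n). \<bar>f (t' (Suc i)) - f (t' i)\<bar>) \<in> S y"
        by (auto simp: S_def simp del: sum.lessThan_Suc)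
      then have "(\<Sum>i<Suc (Suc n). \<bar>f (t' (Suc i)) - f (t' i)\<bar>) \<le> v y"
        unfolding v_def using bddS by (intro cSup_upper)
      moreover have "(\<Sum>i<n. \<bar>f (t' (Suc i)) - f (t' i)\<bar>) = s"
        unfolding s by (intro sum.cong) (auto simp: t'_def)
      ultimately show ?thesis by (simp add: t'_def)
    qed
    then have "v x \<le> v y - \<bar>f y - f x\<bar>"
      unfolding v_def[of x] using zero by (intro cSup_least) auto
    then show ?thesis by simp
  qed
  show thesis
  proof (rule that[of v])
    show "mono v"
      using step by (intro monoI) (smt (verit))
    show "0 \<le> v x" for x
      unfolding v_def using zero bddS by (intro cSup_upper)
    show "v x \<le> total_variation f" for x
      unfolding v_def total_variation_def using zero bdd sub by (intro cSup_subset_mono) auto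
  qed (use step in auto)
qed

text \<open>With the variation function \<open>v\<close>, both \<open>v\<close> and
  \<open>v - f\<close> are monotone, and \<open>f\<close> is their difference.\<close>

lemma bounded_variation_borel:
  assumes "bounded_variation f"
  shows "f \<in> borel_measurable borel"
proof -
  obtain v where v: "mono v" "\<And>x y. x \<le> y \<Longrightarrow> \<bar>f y - f x\<bar> \<le> v y - v x"
    using bounded_variation_dominating_mono[OF assms] by metis
  have "mono (\<lambda>x. v x - f x)"
    using v(2) by (intro monoI) (smt (verit))
  then have "(\<lambda>x. v x - (v x - f x)) \<in> borel_measurable borel"
    using v(1) by (intro borel_measurable_diff borel_measurable_mono)
  then show ?thesis by simp
qed

text \<open>The oscillation of \<open>v\<close> on \<open>A\<close>. A side of a split may be empty,
  where \<open>Sup\<close> and \<open>Inf\<close> carry no information; hence the explicit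
  0.\<close>

definition spread :: "('b \<Rightarrow> real) \<Rightarrow> 'b set \<Rightarrow> real" where
  "spread v A = (if A = {} then 0 else Sup (v ` A) - Inf (v ` A))"

lemma spread_ge:
  assumes "x \<in> A" "y \<in> A" "bdd_above (range v)" "bdd_below (range v)"
  shows "v x - v y \<le> spread v A"
proof -
  have "v x \<le> Sup (v ` A)" "Inf (v ` A) \<le> v y"
    using assms by (auto intro!: cSUP_upper cINF_lower bdd_above_mono[OF assms(3)] bdd_below_mono[OF assms(4)])
  then show ?thesis using assms by (auto simp: spread_def)
qed

lemma spread_nonneg:
  assumes "bdd_above (range v)" "bdd_below (range v)"
  shows "0 \<le> spread v A"
proof (cases "A = {}")
  case False
  then obtain x where "x \<in> A" by auto
  from spread_ge[OF this this assms] show ?thesis by simp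
qed (simp add: spread_def)

lemma spread_least:
  assumes "A \<noteq> {}" "\<And>x y. x \<in> A \<Longrightarrow> y \<in> A \<Longrightarrow> v x - v y \<le> b"
  shows "spread v A \<le> b"
proof -
  have "v x - b \<le> Inf (v ` A)" if "x \<in> A" for x
    using that assms by (intro cINF_greatest) (auto simp: algebra_simps)
  then have "Sup (v ` A) \<le> Inf (v ` A) + b"
    using assms(1) by (intro cSUP_least) (auto simp: algebra_simps)
  then show ?thesis using assms by (simp add: spread_def)
qed

lemma spread_mono:
  assumes "A \<subseteq> B" "bdd_above (range v)" "bdd_below (range v)"
  shows "spread v A \<le> spread v B"
proof (cases "A = {}")
  case True
  then show ?thesis using spread_nonneg[OF assms(2,3)] by (simp add: spread_def)
next
  case False
  then show ?thesis using assms by (intro spread_least spread_ge) auto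
qed

text \<open>For \<open>a\<close>, \<open>a'\<close> in \<open>A\<close> and \<open>x\<close>,
  \<open>y\<close> in \<open>B\<close>, the sum of \<open>v a - v a'\<close> and
  \<open>v x - v y\<close> regroups into \<open>v x - v a'\<close>, at most the oscillation on
  \<open>C\<close>, and \<open>v a - v y\<close>, which is nonpositive.\<close>

lemma spread_separated:
  assumes "A \<subseteq> C" "B \<subseteq> C" "\<And>x y. x \<in> A \<Longrightarrow> y \<in> B \<Longrightarrow> v x \<le> v y"
    and bdd: "bdd_above (range v)" "bdd_below (range v)"
  shows "spread v A + spread v B \<le> spread v C"
proof (cases "A = {} \<or> B = {}")
  case True
  then show ?thesis using spread_mono[OF assms(1) bdd] spread_mono[OF assms(2) bdd]
    by (auto simp: spread_def[of _ "{}"])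
next
  case False
  have "v a - v a' \<le> spread v C - spread v B" if "a \<in> A" "a' \<in> A" for a a'
  proof -
    have "spread v B \<le> spread v C - (v a - v a')"
    proof (rule spread_least)
      fix x y assume "x \<in> B" "y \<in> B"
      then have "v x - v a' \<le> spread v C" "v a \<le> v y"
        using that assms by (auto intro!: spread_ge)
      then show "v x - v y \<le> spread v C - (v a - v a')" by simp
    qed (use False in auto)
    then show ?thesis by simp
  qed
  then have "spread v A \<le> spread v C - spread v B" using False by (intro spread_least) auto
  then show ?thesis by simp
qed

section \<open>Arithmetic of the final bound\<close>

text \<open>AM-GM absorbs the product of \<open>D\<close> and \<open>V\<close> in the second hypothesis, so that \<open>D\<close> appears in the
  conclusion with a factor independent of \<open>V\<close>; when that is too weak, \<open>x \<le> ln 2\<close> suffices.\<close>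
lemma risk_bound_arith:
  fixes x u D V :: real
  assumes "x \<le> ln 2" "x \<le> (ln 2 / 2 + D) * u\<^sup>2 * V" "0 < u" "u \<le> 1" "0 \<le> D" "0 \<le> V"
  shows "x \<le> u * D + sqrt (ln 2 / 4) * u * (sqrt V + V / 2)"
proof -
  define s where "s = sqrt (ln 2)"
  define v where "v = u * sqrt V"
  have s2: "s\<^sup>2 = ln 2" by (simp add: s_def)
  have s: "0 < s" "s \<le> 1" using ln_2_less_1 by (auto simp: s_def)
  have v: "0 \<le> v" "v\<^sup>2 = u\<^sup>2 * V" using assms by (auto simp: v_def power_mult_distrib)
  define R where "R = u * D + s * v\<^sup>2 / (4 * u) + s * v / 2"
  have rhs: "u * D + sqrt (ln 2 / 4) * u * (sqrt V + V / 2) = R"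
    using assms by (simp add: R_def s_def v_def real_sqrt_divide power_mult_distrib field_simps power2_eq_square)
  \<comment> \<open>The factor \<open>u\<close> cancels in the product of the two terms. Hence
    \<open>R\<close> is at least \<open>sqrt s * y + s * v / 2\<close> with
    \<open>y = sqrt D * v\<close>.\<close>
  have amgm: "2 * sqrt (D * s / 4 * v\<^sup>2) \<le> u * D + s * v\<^sup>2 / (4 * u)"
  proof -
    have "sqrt (D * s / 4 * v\<^sup>2) = sqrt ((u * D) * (s * v\<^sup>2 / (4 * u)))" using assms by simp
    also have "\<dots> \<le> (u * D + s * v\<^sup>2 / (4 * u)) / 2"
      using assms s v by (intro arith_geo_mean_sqrt) auto
    finally show ?thesis by simp
  qed
  have "x \<le> R"
  proof (cases "s * v \<le> 1")
    case True
    define y where "y = sqrt D * v"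
    have y: "0 \<le> y" "y\<^sup>2 = D * v\<^sup>2" using assms v by (auto simp: y_def power_mult_distrib)
    have sq: "2 * sqrt (D * s / 4 * v\<^sup>2) = sqrt s * y"
      unfolding y_def using v(1) by (simp add: real_sqrt_mult real_sqrt_divide)
    show ?thesis
    proof (cases "y \<le> sqrt s")
      case True
      \<comment> \<open>In terms of \<open>s * v\<close> and \<open>y\<close> the second hypothesis
        is a sum of squares. One factor of each square is now bounded, by 1 and by
        \<open>sqrt s\<close>.\<close>
      have "x \<le> (s * v) * (s * v) / 2 + y * y"
      proof -
        have "(s * v) * (s * v) / 2 + y * y = s\<^sup>2 * v\<^sup>2 / 2 + y\<^sup>2"
          by (simp add: power2_eq_square)
        also have "\<dots> = (ln 2 / 2 + D) * (u\<^sup>2 * V)"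
          unfolding s2 y(2) v(2) by (simp add: algebra_simps)
        finally show ?thesis using assms(2) by (simp add: mult.assoc)
      qed
      also have "\<dots> \<le> 1 * (s * v) / 2 + sqrt s * y"
        using \<open>s * v \<le> 1\<close> True y s v by (intro add_mono divide_right_mono mult_right_mono) auto
      finally show ?thesis using amgm sq by (simp add: R_def)
    next
      case False
      have "ln 2 \<le> s" using s s2 by (simp add: power2_eq_square flip: s2)
      also have "s = sqrt s * sqrt s" using s by simp
      also have "\<dots> \<le> sqrt s * y" using False s by (intro mult_left_mono) auto
      finally have "ln 2 \<le> sqrt s * y" .
      moreover have "0 \<le> s * v / 2" using s v by simp
      ultimately show ?thesis using assms(1) amgm sq unfolding R_def by linarith
    qed
  next
    case False
    \<comment> \<open>For \<open>s * v > 1\<close> the terms \<open>s * v / 2\<close> and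
      \<open>s * v\<^sup>2 / (4 * u)\<close> are at least 1/2 and 1/4, and 3/4 exceeds
      \<open>ln 2\<close>.\<close>
    have "1 / 4 \<le> s * v\<^sup>2 / 4"
    proof -
      have "1 * 1 \<le> (s * v) * (s * v)" using False by (intro mult_mono) auto
      also have "\<dots> = s * (s * v\<^sup>2)" by (simp add: power2_eq_square)
      also have "\<dots> \<le> 1 * (s * v\<^sup>2)" using s by (intro mult_right_mono) auto
      finally show ?thesis by simp
    qed
    also have "s * v\<^sup>2 / 4 \<le> s * v\<^sup>2 / (4 * u)"
      using assms s by (intro divide_left_mono) auto
    finally have "1 / 4 \<le> s * v\<^sup>2 / (4 * u)" .
    moreover have "0 \<le> u * D" using assms by simp
    ultimately have "3 / 4 \<le> R" using False unfolding R_def by linarith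
    moreover have "ln 2 \<le> (3 / 4 :: real)" using ln2_le_25_over_36 by simp
    ultimately show ?thesis using assms(1) by simp
  qed
  then show ?thesis using rhs by simp
qed

section \<open>Excess risk of a partition\<close>

locale binary_sample = prob_space M
  for M :: "'a measure" +
  fixes X :: "'a \<Rightarrow> real ^ 'n::finite" and Y :: "'a \<Rightarrow> real"
  assumes X_borel [measurable]: "X \<in> borel_measurable M"
    and Y_borel [measurable]: "Y \<in> borel_measurable M"
    and Y_values: "\<And>\<omega>. \<omega> \<in> space M \<Longrightarrow> Y \<omega> = 1 \<or> Y \<omega> = -1"
begin

definition mass :: "real \<Rightarrow> (real ^ 'n) set \<Rightarrow> real" where
  "mass y A = \<P>(\<omega> in M. X \<omega> \<in> A \<and> Y \<omega> = y)"

text \<open>On Borel sets this is \<open>cell_impurity\<close>, by \<open>cell_impurity_eq\<close>.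
  The two label masses are additive in the set, so statements about splits reduce to
  \<open>weighted_entropy\<close>.\<close>

definition impurity :: "(real ^ 'n) set \<Rightarrow> real" where
  "impurity A = weighted_entropy (mass 1 A) (mass (-1) A)"

lemma mass_nonneg [simp]: "0 \<le> mass y A"
  by (simp add: mass_def)

lemma mass_empty [simp]: "mass y {} = 0"
  by (simp add: mass_def)

lemma impurity_empty [simp]: "impurity {} = 0"
  by (simp add: impurity_def)

lemma mass_Un:
  assumes [measurable]: "A \<in> sets borel" "B \<in> sets borel" and "A \<inter> B = {}"
  shows "mass y (A \<union> B) = mass y A + mass y B"
proof -
  have "prob ({\<omega> \<in> space M. X \<omega> \<in> A \<and> Y \<omega> = y} \<union> {\<omega> \<in> space M. X \<omega> \<in> B \<and> Y \<omega> = y}) =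
    mass y A + mass y B"
    unfolding mass_def using assms(3) by (intro finite_measure_Union) auto
  moreover have "{\<omega> \<in> space M. X \<omega> \<in> A \<and> Y \<omega> = y} \<union> {\<omega> \<in> space M. X \<omega> \<in> B \<and> Y \<omega> = y} =
    {\<omega> \<in> space M. X \<omega> \<in> A \<union> B \<and> Y \<omega> = y}" by auto
  ultimately show ?thesis by (simp add: mass_def)
qed

lemma cell_mass_eq:
  assumes [measurable]: "A \<in> sets borel"
  shows "cell_mass M X A = mass 1 A + mass (-1) A"
proof -
  have "prob ({\<omega> \<in> space M. X \<omega> \<in> A \<and> Y \<omega> = 1} \<union> {\<omega> \<in> space M. X \<omega> \<in> A \<and> Y \<omega> = -1}) =
    mass 1 A + mass (-1) A"
    unfolding mass_def by (intro finite_measure_Union) auto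
  moreover have "{\<omega> \<in> space M. X \<omega> \<in> A \<and> Y \<omega> = 1} \<union> {\<omega> \<in> space M. X \<omega> \<in> A \<and> Y \<omega> = -1} =
    {\<omega> \<in> space M. X \<omega> \<in> A}" using Y_values by auto
  ultimately show ?thesis by (simp add: cell_mass_def)
qed

lemma mass_le_1:
  assumes "A \<in> sets borel"
  shows "mass 1 A + mass (-1) A \<le> 1"
  unfolding cell_mass_eq[OF assms, symmetric] by (simp add: cell_mass_def)

lemma cell_eta_eq:
  assumes "A \<in> sets borel"
  shows "cell_eta M X Y A = mass 1 A / (mass 1 A + mass (-1) A)"
proof -
  have "cell_eta M X Y A = mass 1 A / cell_mass M X A"
    by (simp add: cell_eta_def cell_mass_def cond_prob_def mass_def conj_commute)
  then show ?thesis using cell_mass_eq[OF assms] by simp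
qed

lemma cell_impurity_eq:
  assumes "A \<in> sets borel"
  shows "cell_impurity M X Y A = impurity A"
proof -
  let ?p = "mass 1 A" and ?q = "mass (-1) A"
  have *: "cell_impurity M X Y A = (?p + ?q) * binary_entropy (?p / (?p + ?q))"
    by (simp add: cell_impurity_def cell_mass_eq cell_eta_eq assms)
  show ?thesis
  proof (cases "?p = 0 \<or> ?q = 0")
    case True
    then show ?thesis by (auto simp: * impurity_def binary_entropy_def)
  next
    case False
    then have pos: "?p > 0" "?q > 0" using mass_nonneg[of 1 A] mass_nonneg[of "-1" A] by linarith+
    have "(?p + ?q) * binary_entropy (?p / (?p + ?q)) =
      - ((?p + ?q) * (?p / (?p + ?q))) * ln (?p / (?p + ?q)) -
        ((?p + ?q) * (1 - ?p / (?p + ?q))) * ln (1 - ?p / (?p + ?q))"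
      by (simp add: binary_entropy_def algebra_simps)
    also have "(?p + ?q) * (?p / (?p + ?q)) = ?p" using pos by simp
    also have "(?p + ?q) * (1 - ?p / (?p + ?q)) = ?q" using pos by (simp add: field_simps)
    finally show ?thesis
      unfolding * impurity_def weighted_entropy_eq_cross[OF pos] .
  qed
qed

lemma impurity_nonneg: "0 \<le> impurity A"
  by (simp add: impurity_def weighted_entropy_nonneg)

lemma impurity_le_ln_2:
  assumes "A \<in> sets borel"
  shows "impurity A \<le> ln 2"
  using mass_le_1[OF assms] by (simp add: impurity_def weighted_entropy_le_ln_2)

lemma impurity_superadditive:
  assumes "A \<in> sets borel" "B \<in> sets borel" "A \<inter> B = {}"
  shows "impurity A + impurity B \<le> impurity (A \<union> B)"
  using assms by (simp add: impurity_def mass_Un weighted_entropy_superadditive)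

lemma impurity_Un_le:
  assumes A: "A \<in> sets borel" and B: "B \<in> sets borel" and disj: "A \<inter> B = {}"
    and c: "cell_mass M X B \<le> c" "0 < c" "c \<le> 1"
  shows "impurity (A \<union> B) \<le> impurity A + 2 * (c * (1 - ln c))"
proof -
  have "A \<union> B \<in> sets borel" using A B by auto
  from mass_le_1[OF this] show ?thesis
    using c A B disj
    by (simp add: impurity_def mass_Un cell_mass_eq) (intro weighted_entropy_increment, auto)
qed

lemma impurity_le_small:
  assumes "A \<in> sets borel" "cell_mass M X A \<le> c" "0 < c" "c \<le> 1"
  shows "impurity A \<le> 2 * (c * (1 - ln c))"
  using impurity_Un_le[of "{}" A c] assms by simp

lemma cell_of_eq:
  assumes "\<exists>!A. A \<in> Q \<and> x \<in> A" "A \<in> Q" "x \<in> A"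
  shows "cell_of Q x = A"
  unfolding cell_of_def using assms(2,3) by (intro the1_equality[OF assms(1)] conjI)

text \<open>Corrections that depend only on the cell and the label integrate to sums over cells; in
  \<open>excess_risk\<close> they are the tangent corrections.\<close>

lemma expectation_step:
  assumes "finite Q" "\<And>A. A \<in> Q \<Longrightarrow> A \<in> sets borel"
  shows "integrable M (\<lambda>\<omega>. \<Sum>A\<in>Q. a A * indicator A (X \<omega>) * indicator {y} (Y \<omega>))"
    and "(\<integral>\<omega>. (\<Sum>A\<in>Q. a A * indicator A (X \<omega>) * indicator {y} (Y \<omega>)) \<partial>M) = (\<Sum>A\<in>Q. a A * mass y A)"
proof -
  have eq: "(\<Sum>A\<in>Q. a A * indicator A (X \<omega>) * indicator {y} (Y \<omega>)) =
    (\<Sum>A\<in>Q. a A * indicator {\<omega> \<in> space M. X \<omega> \<in> A \<and> Y \<omega> = y} \<omega>)" if "\<omega> \<in> space M" for \<omega>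
    using that by (intro sum.cong) (auto simp: indicator_def)
  have [measurable]: "{\<omega> \<in> space M. X \<omega> \<in> A \<and> Y \<omega> = y} \<in> events" if "A \<in> Q" for A
    using assms(2)[OF that] by measurable
  have int: "integrable M (\<lambda>\<omega>. a A * indicator {\<omega> \<in> space M. X \<omega> \<in> A \<and> Y \<omega> = y} \<omega>)" if "A \<in> Q" for A
    using that by (intro integrable_mult_right integrable_real_indicator) (auto simp: less_top[symmetric])
  show "integrable M (\<lambda>\<omega>. \<Sum>A\<in>Q. a A * indicator A (X \<omega>) * indicator {y} (Y \<omega>))"
    using int by (subst Bochner_Integration.integrable_cong[OF refl eq]) auto
  show "(\<integral>\<omega>. (\<Sum>A\<in>Q. a A * indicator A (X \<omega>) * indicator {y} (Y \<omega>)) \<partial>M) = (\<Sum>A\<in>Q. a A * mass y A)"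
    using int by (subst Bochner_Integration.integral_cong[OF refl eq])
      (auto simp: Bochner_Integration.integral_sum mass_def intro!: sum.cong)
qed

lemma excess_risk:
  assumes fin: "finite Q" and borel: "\<And>A. A \<in> Q \<Longrightarrow> A \<in> sets borel"
    and part: "\<And>x. \<exists>!A. A \<in> Q \<and> x \<in> A"
    and g [measurable]: "g \<in> borel_measurable borel" and bdd: "\<And>x. \<bar>g x\<bar> \<le> B"
    and osc: "\<And>A x y. A \<in> Q \<Longrightarrow> x \<in> A \<Longrightarrow> y \<in> A \<Longrightarrow> g x - g y \<le> b A"
    and b: "\<And>A. 0 \<le> b A"
  shows "(\<integral>\<omega>. logistic_loss (Y \<omega>) (log_odds (cell_eta M X Y (cell_of Q (X \<omega>)))) \<partial>M)
    \<le> (\<integral>\<omega>. ln (1 + exp (- Y \<omega> * g (X \<omega>))) \<partial>M) + (\<Sum>A\<in>Q. impurity A / 2 * b A)"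
proof -
  \<comment> \<open>The interval of \<open>cell_excess_loss\<close> starts at the infimum of
    \<open>g\<close> on the cell and has length \<open>b A\<close>, so it contains all values of
    \<open>g\<close> there.\<close>
  have "\<exists>\<alpha> \<beta>. \<alpha> * mass 1 A + \<beta> * mass (-1) A \<le> impurity A / 2 * b A \<and>
    (\<forall>t. (INF x\<in>A. g x) \<le> t \<and> t \<le> (INF x\<in>A. g x) + b A \<longrightarrow>
      logistic_loss 1 (log_odds (mass 1 A / (mass 1 A + mass (-1) A))) \<le> ln (1 + exp (- t)) + \<alpha> \<and>
      logistic_loss (- 1) (log_odds (mass 1 A / (mass 1 A + mass (-1) A))) \<le> ln (1 + exp t) + \<beta>)" for A
    unfolding impurity_def using b by (intro cell_excess_loss) auto
  then obtain \<alpha> \<beta> where ab: "\<alpha> A * mass 1 A + \<beta> A * mass (-1) A \<le> impurity A / 2 * b A"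
    and loss: "(INF x\<in>A. g x) \<le> t \<Longrightarrow> t \<le> (INF x\<in>A. g x) + b A \<Longrightarrow>
      logistic_loss 1 (log_odds (mass 1 A / (mass 1 A + mass (-1) A))) \<le> ln (1 + exp (- t)) + \<alpha> A \<and>
      logistic_loss (- 1) (log_odds (mass 1 A / (mass 1 A + mass (-1) A))) \<le> ln (1 + exp t) + \<beta> A"
    for A t by metis
  define F where "F \<omega> = ln (1 + exp (- Y \<omega> * g (X \<omega>)))" for \<omega>
  define S where "S a y \<omega> = (\<Sum>A\<in>Q. a A * indicator A (X \<omega>) * indicator {y} (Y \<omega>))"
    for a :: "(real ^ 'n) set \<Rightarrow> real" and y \<omega>
  have "integrable M F"
  proof (rule integrable_const_bound[where B = "ln (1 + exp B)"])
    show "AE \<omega> in M. norm (F \<omega>) \<le> ln (1 + exp B)"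
    proof (rule AE_I2)
      fix \<omega> assume "\<omega> \<in> space M"
      then have "- Y \<omega> * g (X \<omega>) \<le> B" using Y_values[of \<omega>] bdd[of "X \<omega>"] by auto
      then have "ln (1 + exp (- Y \<omega> * g (X \<omega>))) \<le> ln (1 + exp B)"
        by (subst ln_le_cancel_iff) (auto intro: add_pos_pos)
      then show "norm (F \<omega>) \<le> ln (1 + exp B)" unfolding F_def by simp
    qed
    show "F \<in> borel_measurable M" unfolding F_def by measurable
  qed
  note int = this expectation_step[OF fin borel, folded S_def]
  have le: "logistic_loss (Y \<omega>) (log_odds (cell_eta M X Y (cell_of Q (X \<omega>)))) \<le>
      F \<omega> + S \<alpha> 1 \<omega> + S \<beta> (-1) \<omega>" if \<omega>: "\<omega> \<in> space M" for \<omega>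
  proof -
    obtain A where A: "A \<in> Q" "X \<omega> \<in> A" using part by blast
    have cell: "cell_of Q (X \<omega>) = A" using cell_of_eq[OF part A] .
    have other: "indicator A' (X \<omega>) = (0::real)" if "A' \<in> Q - {A}" for A'
      using part[of "X \<omega>"] A that by (auto simp: indicator_def)
    have "S a y \<omega> = a A * indicator {y} (Y \<omega>)" for a y
      unfolding S_def using fin A other by (subst sum.remove[of _ A]) auto
    moreover have "bdd_below (g ` A)" using bdd by (intro bdd_belowI2[of _ "- B"]) (metis abs_le_D2 minus_le_iff)
    then have "(INF x\<in>A. g x) \<le> g (X \<omega>)" using A by (intro cINF_lower)
    moreover have "g (X \<omega>) - b A \<le> (INF x\<in>A. g x)"
      using A osc[of A "X \<omega>"] by (intro cINF_greatest) (auto simp: algebra_simps)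
    ultimately show ?thesis
      using loss[of A "g (X \<omega>)"] Y_values[OF \<omega>] unfolding cell cell_eta_eq[OF borel[OF A(1)]]
      by (auto simp: F_def)
  qed
  \<comment> \<open>The majorant is integrable and, lying above a nonnegative loss, nonnegative, as
    \<open>integral_mono'\<close> requires.\<close>
  have "(\<integral>\<omega>. logistic_loss (Y \<omega>) (log_odds (cell_eta M X Y (cell_of Q (X \<omega>)))) \<partial>M)
    \<le> (\<integral>\<omega>. F \<omega> + S \<alpha> 1 \<omega> + S \<beta> (-1) \<omega> \<partial>M)"
    by (intro integral_mono' Bochner_Integration.integrable_add int le order_trans[OF logistic_loss_nonneg le])
  also have "\<dots> = (\<integral>\<omega>. F \<omega> \<partial>M) + ((\<Sum>A\<in>Q. \<alpha> A * mass 1 A) + (\<Sum>A\<in>Q. \<beta> A * mass (-1) A))"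
    by (simp only: int Bochner_Integration.integral_add Bochner_Integration.integrable_add add.assoc)
  also have "(\<Sum>A\<in>Q. \<alpha> A * mass 1 A) + (\<Sum>A\<in>Q. \<beta> A * mass (-1) A) \<le> (\<Sum>A\<in>Q. impurity A / 2 * b A)"
    unfolding sum.distrib[symmetric] using ab by (intro sum_mono)
  finally show ?thesis by (simp add: F_def)
qed

section \<open>Unsplittable cells\<close>

text \<open>Singletons are Borel in a T1 space, so equality with \<open>c\<close> can be pulled back
  through the image measure and the conditioning to an almost sure statement under
  \<open>M\<close>.\<close>

lemma cond_law_point_mass:
  fixes Z :: "'a \<Rightarrow> 'b::{second_countable_topology, t1_space}"
  assumes "point_mass (cond_law M X A Z)" "cell_mass M X A > 0"
    and [measurable]: "A \<in> sets borel" "Z \<in> borel_measurable M"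
  obtains c where "AE \<omega> in M. X \<omega> \<in> A \<longrightarrow> Z \<omega> = c"
proof -
  let ?E = "{\<omega> \<in> space M. X \<omega> \<in> A}"
  have E: "?E \<in> events" "prob ?E > 0" using assms by (auto simp: cell_mass_def)
  from assms obtain c where c: "distr (uniform_measure M ?E) borel Z = return borel c"
    by (auto simp: point_mass_def cond_law_def)
  have "AE z in return borel c. z = c"
    by (subst AE_return) (auto simp: pred_def)
  then have "AE z in distr (uniform_measure M ?E) borel Z. z = c" unfolding c .
  then have "AE \<omega> in uniform_measure M ?E. Z \<omega> = c"
    by (subst (asm) AE_distr_iff) auto
  then have "AE \<omega> in M. \<omega> \<in> ?E \<longrightarrow> Z \<omega> = c"
    using E by (subst (asm) AE_uniform_measure) (auto simp: emeasure_eq_measure)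
  then show thesis by (intro that[of c]) (auto elim!: AE_mp)
qed

lemma mass_eq_0:
  assumes "AE \<omega> in M. X \<omega> \<in> A \<longrightarrow> Y \<omega> \<noteq> y"
  shows "mass y A = 0"
  unfolding mass_def using assms by (intro prob_eq_0_AE) (auto elim!: AE_mp)

text \<open>A cell that is kept is not halved, but its impurity is already below the error: a null
  or one-point cell has mass at most \<open>c\<close>, and a cell with one label has impurity
  0.\<close>

lemma unsplittable_impurity:
  assumes "unsplittable M X Y A" and A [measurable]: "A \<in> sets borel"
    and c: "\<And>j u. \<P>(\<omega> in M. X \<omega> $ j = u) \<le> c" "0 < c" "c \<le> 1"
  shows "impurity A \<le> 2 * (c * (1 - ln c))"
proof -
  consider "cell_mass M X A = 0"
    | "cell_mass M X A > 0" "point_mass (cond_law M X A Y)"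
    | "cell_mass M X A > 0" "point_mass (cond_law M X A X)"
    using assms(1) by (auto simp: unsplittable_def)
  then show ?thesis
  proof cases
    case 1
    then show ?thesis using A c by (intro impurity_le_small) auto
  next
    case 2
    obtain y where y: "AE \<omega> in M. X \<omega> \<in> A \<longrightarrow> Y \<omega> = y"
      by (rule cond_law_point_mass[OF 2(2,1) A Y_borel])
    \<comment> \<open>A label different from \<open>y\<close>, whichever real number
      \<open>y\<close> is.\<close>
    have "mass (if y = 1 then -1 else 1) A = 0"
      using y by (intro mass_eq_0) (auto elim!: AE_mp)
    then have "impurity A = 0" by (auto simp: impurity_def split: if_splits)
    moreover have "ln c \<le> 0" using c by simp
    then have "0 \<le> c * (1 - ln c)" using c(2) by (intro mult_nonneg_nonneg) linarith+
    ultimately show ?thesis by simp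
  next
    case 3
    obtain x where x: "AE \<omega> in M. X \<omega> \<in> A \<longrightarrow> X \<omega> = x"
      by (rule cond_law_point_mass[OF 3(2,1) A X_borel])
    \<comment> \<open>Here \<open>undefined\<close> serves as an arbitrary coordinate: a point lies
      in a level set of each of them.\<close>
    have "cell_mass M X A \<le> \<P>(\<omega> in M. X \<omega> $ undefined = x $ undefined)"
      unfolding cell_mass_def
    proof (rule finite_measure_mono_AE)
      show "AE \<omega> in M. \<omega> \<in> {\<omega> \<in> space M. X \<omega> \<in> A} \<longrightarrow>
        \<omega> \<in> {\<omega> \<in> space M. X \<omega> $ undefined = x $ undefined}"
        using x by eventually_elim auto
    qed measurable
    also have "\<dots> \<le> c" by (rule c)
    finally show ?thesis using A c by (intro impurity_le_small) auto
  qed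
qed

end

section \<open>Refinement of partitions\<close>

text \<open>Only an inequality, since the families may share members: several cells can produce the
  empty set as a side.\<close>

lemma sum_UN_le:
  fixes f :: "'b \<Rightarrow> real"
  assumes "finite Q" "\<And>A. A \<in> Q \<Longrightarrow> finite (B A)" "\<And>x. 0 \<le> f x"
  shows "sum f (\<Union>A\<in>Q. B A) \<le> (\<Sum>A\<in>Q. sum f (B A))"
  using assms(1,2)
proof (induction Q rule: finite_induct)
  case (insert A Q)
  have "sum f (B A \<union> (\<Union>A\<in>Q. B A)) + sum f (B A \<inter> (\<Union>A\<in>Q. B A)) =
    sum f (B A) + sum f (\<Union>A\<in>Q. B A)"
    using insert by (intro sum.union_inter) auto
  moreover have "0 \<le> sum f (B A \<inter> (\<Union>A\<in>Q. B A))" using assms(3) by (intro sum_nonneg)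
  ultimately show ?case using insert by simp
qed simp

lemma partition_refine:
  assumes "\<exists>!A. A \<in> Q \<and> x \<in> A" "\<And>A C. A \<in> Q \<Longrightarrow> C \<in> B A \<Longrightarrow> C \<subseteq> A"
    and "\<And>A. A \<in> Q \<Longrightarrow> x \<in> A \<Longrightarrow> \<exists>!C. C \<in> B A \<and> x \<in> C"
  shows "\<exists>!C. C \<in> (\<Union>A\<in>Q. B A) \<and> x \<in> C"
proof -
  obtain A where A: "A \<in> Q" "x \<in> A" using assms(1) by auto
  obtain C where C: "C \<in> B A" "x \<in> C" using assms(3)[OF A] by auto
  show ?thesis
  proof (rule ex1I[of _ C])
    show "C \<in> (\<Union>A\<in>Q. B A) \<and> x \<in> C" using A C by auto
    fix C' assume "C' \<in> (\<Union>A\<in>Q. B A) \<and> x \<in> C'"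
    then obtain A' where A': "A' \<in> Q" "C' \<in> B A'" "x \<in> C'" by auto
    have "x \<in> A'" using assms(2)[OF A'(1,2)] A'(3) by auto
    then have "A' = A" using assms(1) A A'(1) by (auto elim: ex1E)
    then show "C' = C" using assms(3)[OF A] A' C by (auto elim: ex1E)
  qed
qed

text \<open>The numbers \<open>q * d + e\<close> with \<open>q < k div d\<close> are distinct and
  lie below \<open>k\<close>, being smaller than \<open>Suc q * d\<close>.\<close>

lemma card_residue_ge:
  fixes d e :: nat
  assumes "e < d"
  shows "k div d \<le> card {i. i < k \<and> i mod d = e}"
proof -
  have "card ((\<lambda>q. q * d + e) ` {..<k div d}) \<le> card {i. i < k \<and> i mod d = e}"
  proof (intro card_mono subsetI)
    fix i assume "i \<in> (\<lambda>q. q * d + e) ` {..<k div d}"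
    then obtain q where q: "q < k div d" "i = q * d + e" by auto
    have "i < Suc q * d" using q assms by simp
    also have "\<dots> \<le> k div d * d" using q by (intro mult_le_mono1) auto
    also have "\<dots> \<le> k" by simp
    finally show "i \<in> {i. i < k \<and> i mod d = e}" using q assms by simp
  qed auto
  moreover have "inj_on (\<lambda>q. q * d + e) {..<k div d}" using assms by (auto simp: inj_on_def)
  ultimately show ?thesis by (simp add: card_image)
qed

lemma split_left_subset: "split_left j z A \<subseteq> A"
  and split_right_subset: "split_right j z A \<subseteq> A"
  by (auto simp: split_left_def split_right_def)

lemma split_right_eq: "split_right j z A = {x \<in> A. z \<le> x $ j}"
  by (auto simp: split_right_def split_left_def)

lemma split_borel:
  fixes A :: "(real ^ 'n::finite) set"
  assumes [measurable]: "A \<in> sets borel"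
  shows "split_left j z A \<in> sets borel" "split_right j z A \<in> sets borel"
proof -
  have "open {x :: real ^ 'n. x $ j < z}" by (simp add: open_halfspace_component_lt_cart)
  then have "A \<inter> {x. x $ j < z} \<in> sets borel" using assms by auto
  then show *: "split_left j z A \<in> sets borel"
    by (simp add: split_left_def Int_def)
  show "split_right j z A \<in> sets borel"
    unfolding split_right_def using * assms by auto
qed

lemma ex1_split:
  assumes "x \<in> A"
  shows "\<exists>!C. C \<in> {split_left j z A, split_right j z A} \<and> x \<in> C"
proof (cases "x $ j < z")
  case True
  then show ?thesis using assms
    by (intro ex1I[of _ "split_left j z A"]) (auto simp: split_left_def split_right_def)
next
  case False
  then show ?thesis using assms
    by (intro ex1I[of _ "split_right j z A"]) (auto simp: split_left_def split_right_def)
qed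

section \<open>Halving the impurity\<close>

context binary_sample
begin

lemma mass_eq_0_of_AE_notin:
  assumes "AE \<omega> in M. X \<omega> \<notin> A"
  shows "mass y A = 0"
  by (rule mass_eq_0) (use assms in eventually_elim, auto)

text \<open>Compare the last support value \<open>u\<close> at which the left part is still the lighter one with its
  successor \<open>u'\<close>: moving the threshold from \<open>u\<close> to \<open>u'\<close> transfers a single layer.\<close>
lemma balanced_threshold:
  assumes A: "A \<in> sets borel" and U: "finite U" "AE \<omega> in M. X \<omega> $ j \<in> U"
    and c: "\<And>u. \<P>(\<omega> in M. X \<omega> $ j = u) \<le> c" "0 < c" "c \<le> 1"
  shows "\<exists>z. 2 * max (impurity (split_left j z A)) (impurity (split_right j z A))
    \<le> impurity A + 2 * (c * (1 - ln c))"
proof -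
  define E where "E = 2 * (c * (1 - ln c))"
  define L where "L z = impurity (split_left j z A)" for z
  define R where "R z = impurity (split_right j z A)" for z
  \<comment> \<open>Above every support value, so that almost nothing remains to its right. With 0
    inserted, \<open>Max\<close> is taken over a visibly nonempty set.\<close>
  define top where "top = Max (insert 0 U) + 1"
  define Z where "Z = insert top (insert 0 U)"
  have Z: "finite Z" "Z \<noteq> {}" "U \<subseteq> Z" using U by (auto simp: Z_def)
  have below_top: "u < top" if "u \<in> insert 0 U" for u
  proof -
    have "u \<le> Max (insert 0 U)" using that U(1) by (intro Max_ge) auto
    then show ?thesis by (simp add: top_def)
  qed
  have borel: "split_left j z A \<in> sets borel" "split_right j z A \<in> sets borel" for z
    using split_borel[OF A] by auto
  have LR: "L z + R z \<le> impurity A" for z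
  proof -
    have "split_left j z A \<union> split_right j z A = A" "split_left j z A \<inter> split_right j z A = {}"
      by (auto simp: split_left_def split_right_def)
    then show ?thesis using impurity_superadditive[OF borel, of z z] by (simp add: L_def R_def)
  qed
  have nonneg: "0 \<le> L z" "0 \<le> R z" for z by (simp_all add: L_def R_def impurity_nonneg)
  have "ln c \<le> 0" using c by simp
  then have E: "0 \<le> E" unfolding E_def using c by (intro mult_nonneg_nonneg) linarith+
  \<comment> \<open>Almost nothing lies to the left of the smallest threshold, so some threshold in
    \<open>Z\<close> has the lighter side on the left and \<open>u\<close> below is well
    defined.\<close>
  have "L (Min Z) = 0"
  proof -
    have "AE \<omega> in M. X \<omega> \<notin> split_left j (Min Z) A"
      using U(2) by eventually_elim (use Z in \<open>auto simp: split_left_def not_less\<close>)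
    then show ?thesis by (simp add: L_def impurity_def mass_eq_0_of_AE_notin)
  qed
  have "R top = 0"
  proof -
    have "AE \<omega> in M. X \<omega> \<notin> split_right j top A"
      using U(2) by eventually_elim (use below_top in \<open>fastforce simp: split_right_eq\<close>)
    then show ?thesis by (simp add: R_def impurity_def mass_eq_0_of_AE_notin)
  qed
  define u where "u = Max {z \<in> Z. L z \<le> R z}"
  have G: "finite {z \<in> Z. L z \<le> R z}" "Min Z \<in> {z \<in> Z. L z \<le> R z}"
    using Z \<open>L (Min Z) = 0\<close> nonneg by auto
  then have u: "u \<in> Z" "L u \<le> R u"
    using Max_in[of "{z \<in> Z. L z \<le> R z}"] unfolding u_def by auto
  have u_max: "z \<le> u" if "z \<in> Z" "L z \<le> R z" for z
    using Max_ge[OF G(1), of z] that unfolding u_def by auto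
  have "\<exists>z. 2 * max (L z) (R z) \<le> impurity A + E"
  proof (cases "u = top")
    case True
    then have "max (L top) (R top) = 0" using u nonneg[of top] \<open>R top = 0\<close> by simp
    then show ?thesis using E impurity_nonneg[of A] by (intro exI[of _ top]) simp
  next
    case False
    then have "u < top" using u(1) below_top[of u] by (simp add: Z_def)
    define u' where "u' = Min {z \<in> Z. u < z}"
    have fin: "finite {z \<in> Z. u < z}" "top \<in> {z \<in> Z. u < z}"
      using Z \<open>u < top\<close> by (auto simp: Z_def)
    have "u' \<in> {z \<in> Z. u < z}" unfolding u'_def using fin(2) by (intro Min_in[OF fin(1)]) blast
    then have u': "u' \<in> Z" "u < u'" by auto
    have gap: "u' \<le> z" if "z \<in> Z" "u < z" for z
      using Min_le[OF fin(1), of z] that unfolding u'_def by auto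
    have "R u' < L u'" using u_max[OF u'(1)] u'(2) by linarith
    \<comment> \<open>The layer transferred between \<open>u\<close> and \<open>u'\<close>. No
      support value lies strictly between them, so up to a null set the layer is contained in the
      level set of \<open>u\<close>.\<close>
    define B where "B = split_right j u (split_left j u' A)"
    have B: "B \<in> sets borel" unfolding B_def using split_borel A by blast
    have "cell_mass M X B \<le> \<P>(\<omega> in M. X \<omega> $ j = u)"
      unfolding cell_mass_def
    proof (rule finite_measure_mono_AE)
      show "AE \<omega> in M. \<omega> \<in> {\<omega> \<in> space M. X \<omega> \<in> B} \<longrightarrow> \<omega> \<in> {\<omega> \<in> space M. X \<omega> $ j = u}"
        using U(2)
      proof eventually_elim
        case (elim \<omega>)
        have "X \<omega> $ j = u" if "X \<omega> \<in> B"
          using that gap[of "X \<omega> $ j"] elim Z(3) by (force simp: B_def split_left_def split_right_eq)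
        then show ?case by auto
      qed
    qed measurable
    then have Bc: "cell_mass M X B \<le> c" using c(1)[of u] by linarith
    have un: "split_left j u' A = split_left j u A \<union> B" "split_left j u A \<inter> B = {}"
      "split_right j u A = split_right j u' A \<union> B" "split_right j u' A \<inter> B = {}"
      using u'(2) by (auto simp: B_def split_left_def split_right_eq)
    have "L u' \<le> L u + E"
      unfolding L_def un(1) E_def using un(2) Bc c B borel by (intro impurity_Un_le) auto
    moreover have "R u \<le> R u' + E"
      unfolding R_def un(3) E_def using un(4) Bc c B borel by (intro impurity_Un_le) auto
    \<comment> \<open>\<open>R u\<close> and \<open>L u'\<close> are the larger sides at the two
      thresholds. Their sum is at most \<open>impurity A + E\<close>, so one of them is at most half
      of that.\<close>
    ultimately have "L u' + R u \<le> impurity A + E" using LR[of u] LR[of u'] by linarith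
    then have "2 * max (L u) (R u) \<le> impurity A + E \<or> 2 * max (L u') (R u') \<le> impurity A + E"
      using u(2) \<open>R u' < L u'\<close> by (simp add: max_def) linarith
    then show ?thesis by blast
  qed
  then show ?thesis by (simp add: L_def R_def E_def)
qed

text \<open>The chosen threshold does at least as well as the balanced one in the larger of the two
  impurities, and this bounds both children.\<close>

lemma minimax_split_impurity:
  assumes A: "A \<in> sets borel" and U: "finite U" "AE \<omega> in M. X \<omega> $ j \<in> U"
    and c: "\<And>u. \<P>(\<omega> in M. X \<omega> $ j = u) \<le> c" "0 < c" "c \<le> 1"
    and z: "is_arg_min (split_objective M X Y j A) (\<lambda>_. True) z"
    and C: "C \<in> {split_left j z A, split_right j z A}"
  shows "2 * impurity C \<le> impurity A + 2 * (c * (1 - ln c))"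
proof -
  have obj: "split_objective M X Y j A z' =
    max (impurity (split_left j z' A)) (impurity (split_right j z' A))" for z'
    by (simp add: split_objective_def cell_impurity_eq split_borel A)
  obtain z' where z': "2 * max (impurity (split_left j z' A)) (impurity (split_right j z' A))
    \<le> impurity A + 2 * (c * (1 - ln c))"
    using balanced_threshold[OF A U c] by auto
  have "impurity C \<le> split_objective M X Y j A z"
    using C unfolding obj by auto
  also have "\<dots> \<le> split_objective M X Y j A z'"
    using z by (auto simp: is_arg_min_def not_less)
  finally show ?thesis using z' unfolding obj by linarith
qed

end

section \<open>Impurity and oscillation along a run of the algorithm\<close>

locale minimax_run = binary_sample M X Y
  for M :: "'a measure" and X :: "'a \<Rightarrow> real ^ 'n::finite" and Y :: "'a \<Rightarrow> real" +
  fixes coord :: "nat \<Rightarrow> 'n" and P :: "nat \<Rightarrow> (real ^ 'n) set set"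
  assumes coord: "bij_betw coord {1..CARD('n)} UNIV"
    and run: "cyclic_minimax_split M X Y coord P"
begin

definition split_axis :: "nat \<Rightarrow> 'n" where
  "split_axis k = coord (1 + k mod CARD('n))"

lemma P_0: "P 0 = {UNIV}"
  using run by (simp add: cyclic_minimax_split_def)

definition children :: "nat \<Rightarrow> real \<Rightarrow> (real ^ 'n) set \<Rightarrow> (real ^ 'n) set set" where
  "children k z A = (if unsplittable M X Y A then {A}
    else {split_left (split_axis k) z A, split_right (split_axis k) z A})"

lemma P_Suc:
  "\<exists>z. (\<forall>A \<in> P k. \<not> unsplittable M X Y A \<longrightarrow>
      is_arg_min (split_objective M X Y (split_axis k) A) (\<lambda>_. True) (z A)) \<and>
    P (Suc k) = (\<Union>A \<in> P k. children k (z A) A)"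
  unfolding split_axis_def children_def
  by (rule run[unfolded cyclic_minimax_split_def Let_def, THEN conjunct2, THEN spec])

lemma finite_P: "finite (P k)"
proof (induction k)
  case (Suc k)
  obtain z where "P (Suc k) = (\<Union>A \<in> P k. children k (z A) A)" using P_Suc[of k] by auto
  then show ?case using Suc by (auto simp: children_def)
qed (simp add: P_0)

lemma borel_P: "A \<in> P k \<Longrightarrow> A \<in> sets borel"
proof (induction k arbitrary: A)
  case (Suc k)
  obtain z where "P (Suc k) = (\<Union>A \<in> P k. children k (z A) A)" using P_Suc[of k] by auto
  with Suc.prems obtain B where "B \<in> P k" "A = B \<or> (\<exists>z. A = split_left (split_axis k) z B \<or> A = split_right (split_axis k) z B)"
    by (auto simp: children_def split: if_splits)
  then show ?case using Suc.IH[of B] split_borel[of B] by auto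
qed (simp add: P_0)

lemma partition_P: "\<exists>!A. A \<in> P k \<and> x \<in> A"
proof (induction k)
  case (Suc k)
  obtain z where P: "P (Suc k) = (\<Union>A \<in> P k. children k (z A) A)" using P_Suc[of k] by auto
  show ?case unfolding P
  proof (rule partition_refine[OF Suc.IH])
    fix A C assume "C \<in> children k (z A) A"
    then show "C \<subseteq> A"
      by (auto simp: children_def split: if_splits
        dest: subsetD[OF split_left_subset] subsetD[OF split_right_subset])
  next
    fix A assume "x \<in> A"
    then show "\<exists>!C. C \<in> children k (z A) A \<and> x \<in> C"
      using ex1_split[of x A] by (auto simp: children_def)
  qed
qed (auto simp: P_0)

text \<open>With the error \<open>E = 2 * (c * (1 - ln c))\<close>, a split takes a bound
  \<open>x\<close> to \<open>(x + E) / 2\<close>. This map fixes \<open>E\<close>, so the excess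
  over \<open>E\<close> halves in each round; cells that are kept are already below
  \<open>E\<close>.\<close>

lemma impurity_P_le:
  assumes fin: "\<exists>S. finite S \<and> (AE \<omega> in M. X \<omega> \<in> S)"
    and c: "\<And>j u. \<P>(\<omega> in M. X \<omega> $ j = u) \<le> c" "0 < c" "c \<le> 1"
    and "A \<in> P k"
  shows "impurity A \<le> ln 2 / 2 ^ k + 2 * (c * (1 - ln c))"
  using \<open>A \<in> P k\<close>
proof (induction k arbitrary: A)
  case 0
  have "ln c \<le> 0" using c by simp
  then have "0 \<le> c * (1 - ln c)" using c by (intro mult_nonneg_nonneg) linarith+
  then show ?case using impurity_le_ln_2[OF borel_P[OF 0]] by simp
next
  case (Suc k)
  define E where "E = 2 * (c * (1 - ln c))"
  obtain S where S: "finite S" "AE \<omega> in M. X \<omega> \<in> S" using fin by auto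
  obtain z where z: "\<forall>A\<in>P k. \<not> unsplittable M X Y A \<longrightarrow>
      is_arg_min (split_objective M X Y (split_axis k) A) (\<lambda>_. True) (z A)"
    and P: "P (Suc k) = (\<Union>A \<in> P k. children k (z A) A)" using P_Suc[of k] by auto
  from Suc.prems[unfolded P] obtain B where B: "B \<in> P k"
    and AB: "A \<in> children k (z B) B" by auto
  show ?case
  proof (cases "unsplittable M X Y B")
    case True
    then have "impurity A \<le> E"
      unfolding E_def using AB True unsplittable_impurity[OF True borel_P[OF B] c] by (simp add: children_def)
    moreover have "0 \<le> ln 2 / (2 :: real) ^ Suc k" by simp
    ultimately show ?thesis unfolding E_def by linarith
  next
    case False
    have "AE \<omega> in M. X \<omega> $ split_axis k \<in> (\<lambda>x. x $ split_axis k) ` S"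
      using S(2) by eventually_elim auto
    then have "2 * impurity A \<le> impurity B + E"
      unfolding E_def using AB False S(1) z B
      by (intro minimax_split_impurity[where z = "z B", OF borel_P[OF B] _ _ c]) (auto simp: children_def)
    also have "impurity B \<le> ln 2 / 2 ^ k + E" unfolding E_def using Suc.IH[OF B] .
    finally show ?thesis by (simp add: E_def)
  qed
qed

text \<open>A split along \<open>j\<close> separates the values of the monotone \<open>v\<close>, so
  the oscillations of the two sides add up to at most that of the cell. Any other split at most
  doubles it.\<close>

lemma sum_spread_P_le:
  assumes v: "mono v" "\<And>x. 0 \<le> v x" "\<And>x. v x \<le> V"
  shows "(\<Sum>A\<in>P k. spread (\<lambda>x. v (x $ j)) A) \<le> V * 2 ^ k / 2 ^ card {i. i < k \<and> split_axis i = j}"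
proof (induction k)
  case 0
  have "spread (\<lambda>x :: real ^ 'n. v (x $ j)) UNIV \<le> V"
  proof (rule spread_least)
    fix x y :: "real ^ 'n"
    show "v (x $ j) - v (y $ j) \<le> V" using v(2)[of "y $ j"] v(3)[of "x $ j"] by linarith
  qed auto
  then show ?case by (simp add: P_0)
next
  case (Suc k)
  let ?s = "spread (\<lambda>x :: real ^ 'n. v (x $ j))"
  let ?m = "if split_axis k = j then 1 else 2 :: real"
  have bdd: "bdd_above (range (\<lambda>x :: real ^ 'n. v (x $ j)))" "bdd_below (range (\<lambda>x :: real ^ 'n. v (x $ j)))"
    using v by (auto intro!: bdd_aboveI2 bdd_belowI2)
  note nonneg = spread_nonneg[OF bdd]
  obtain z where P: "P (Suc k) = (\<Union>A \<in> P k. children k (z A) A)" using P_Suc[of k] by auto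
  have "(\<Sum>A\<in>P (Suc k). ?s A) \<le> (\<Sum>A\<in>P k. sum ?s (children k (z A) A))"
    unfolding P using finite_P nonneg by (intro sum_UN_le) (auto simp: children_def)
  also have "\<dots> \<le> (\<Sum>A\<in>P k. ?m * ?s A)"
  proof (rule sum_mono)
    fix A
    let ?L = "split_left (split_axis k) (z A) A" and ?R = "split_right (split_axis k) (z A) A"
    \<comment> \<open>If the sides coincide, which happens for empty \<open>A\<close>, the set has a
      single member.\<close>
    have "sum ?s {?L, ?R} \<le> ?s ?L + ?s ?R"
      using nonneg[of ?L] by (cases "?L = ?R") auto
    also have "\<dots> \<le> ?m * ?s A"
    proof (cases "split_axis k = j")
      case True
      have "?s ?L + ?s ?R \<le> ?s A"
        using v(1) True split_left_subset split_right_subset bdd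
        by (intro spread_separated) (auto simp: split_left_def split_right_eq intro!: monoD[OF v(1)])
      then show ?thesis using True by simp
    next
      case False
      then show ?thesis
        using spread_mono[OF split_left_subset bdd, of "split_axis k" "z A" A]
          spread_mono[OF split_right_subset bdd, of "split_axis k" "z A" A] by simp
    qed
    finally have "sum ?s {?L, ?R} \<le> ?m * ?s A" .
    moreover have "?s A \<le> ?m * ?s A" using nonneg[of A] by simp
    ultimately show "sum ?s (children k (z A) A) \<le> ?m * ?s A"
      unfolding children_def by (cases "unsplittable M X Y A") (simp_all only: if_True if_False, simp)
  qed
  also have "\<dots> = ?m * (\<Sum>A\<in>P k. ?s A)" by (simp add: sum_distrib_left)
  also have "\<dots> \<le> ?m * (V * 2 ^ k / 2 ^ card {i. i < k \<and> split_axis i = j})"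
    using Suc.IH by (intro mult_left_mono) auto
  also have "\<dots> = V * 2 ^ Suc k / 2 ^ card {i. i < Suc k \<and> split_axis i = j}"
  proof (cases "split_axis k = j")
    case True
    then have "{i. i < Suc k \<and> split_axis i = j} = insert k {i. i < k \<and> split_axis i = j}"
      by (auto simp: less_Suc_eq)
    then show ?thesis using True by simp
  next
    case False
    then have "{i. i < Suc k \<and> split_axis i = j} = {i. i < k \<and> split_axis i = j}"
      by (auto simp: less_Suc_eq)
    then show ?thesis using False by simp
  qed
  finally show ?case .
qed

lemma card_axis_ge: "k div CARD('n) \<le> card {i. i < k \<and> split_axis i = j}"
proof -
  have "j \<in> coord ` {1..CARD('n)}" using coord by (auto simp: bij_betw_def)
  then obtain e where e: "e \<in> {1..CARD('n)}" "coord e = j" by auto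
  \<comment> \<open>\<open>coord\<close> counts from 1, residues from 0.\<close>
  then have "e - 1 < CARD('n)" by auto
  then have "k div CARD('n) \<le> card {i. i < k \<and> i mod CARD('n) = e - 1}"
    by (rule card_residue_ge)
  also have "\<dots> \<le> card {i. i < k \<and> split_axis i = j}"
    using e by (intro card_mono) (auto simp: split_axis_def)
  finally show ?thesis .
qed

abbreviation risk :: "nat \<Rightarrow> real" where
  "risk k \<equiv> (\<integral>\<omega>. logistic_loss (Y \<omega>) (log_odds_process M X Y P k \<omega>) \<partial>M)"

text \<open>Comparison with \<open>g = 0\<close>, which has loss \<open>ln 2\<close> and no
  oscillation.\<close>

lemma risk_le_ln_2: "risk k \<le> ln 2"
  using excess_risk[where g = "\<lambda>_. 0" and B = 0 and b = "\<lambda>_. 0",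
    OF finite_P[of k] borel_P partition_P]
  by (simp add: log_odds_process_def prob_space)

text \<open>The uniform impurity bound multiplies the total oscillation over all cells. Each
  component of \<open>g\<close> is controlled by its variation function \<open>v i\<close>, which is
  monotone as \<open>sum_spread_P_le\<close> demands.\<close>

lemma risk_le_additive:
  assumes fin: "\<exists>S. finite S \<and> (AE \<omega> in M. X \<omega> \<in> S)"
    and N: "\<And>j u. \<P>(\<omega> in M. X \<omega> $ j = u) \<le> 1 / N" "1 \<le> N"
    and G: "G \<in> additive_reps g"
  shows "risk k \<le> (\<integral>\<omega>. ln (1 + exp (- Y \<omega> * g (X \<omega>))) \<partial>M) +
    (ln 2 / 2 + 2 ^ k * ln (exp 1 * N) / N) / 2 ^ (k div CARD('n)) * (\<Sum>i\<in>UNIV. total_variation (G i))"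
proof -
  define V where "V = (\<Sum>i\<in>UNIV. total_variation (G i))"
  \<comment> \<open>The bound of \<open>impurity_P_le\<close> for \<open>c = 1 / N\<close>, where
    \<open>c * (1 - ln c) = ln (exp 1 * N) / N\<close>.\<close>
  define H where "H = ln 2 / 2 ^ k + 2 * (ln (exp 1 * N) / N)"
  have bv: "bounded_variation (G i)" for i using G by (simp add: additive_reps_def)
  have g: "g = (\<lambda>x. \<Sum>i\<in>UNIV. G i (x $ i))" using G by (simp add: additive_reps_def)
  have "\<exists>v. mono v \<and> (\<forall>x. 0 \<le> v x \<and> v x \<le> total_variation (G i)) \<and>
    (\<forall>x y. x \<le> y \<longrightarrow> \<bar>G i y - G i x\<bar> \<le> v y - v x)" for i
    using bounded_variation_dominating_mono[OF bv[of i]] by metis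
  then obtain v where v: "\<And>i. mono (v i)" "\<And>i x. 0 \<le> v i x" "\<And>i x. v i x \<le> total_variation (G i)"
    and Gv: "\<And>i x y. x \<le> y \<Longrightarrow> \<bar>G i y - G i x\<bar> \<le> v i y - v i x" by metis
  have Gv': "\<bar>G i x - G i y\<bar> \<le> \<bar>v i x - v i y\<bar>" for i x y
    using Gv[of x y i] Gv[of y x i] by (cases "x \<le> y") auto
  have TV: "0 \<le> total_variation (G i)" for i using v(2,3) order_trans by blast
  have bdd: "bdd_above (range (\<lambda>x :: real ^ 'n. v i (x $ i)))" "bdd_below (range (\<lambda>x :: real ^ 'n. v i (x $ i)))" for i
    using v by (auto intro!: bdd_aboveI2 bdd_belowI2)
  have sub: "g x - g y \<le> (\<Sum>i\<in>UNIV. \<bar>v i (x $ i) - v i (y $ i)\<bar>)" for x y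
    unfolding g sum_subtractf[symmetric] using Gv' by (intro sum_mono) (meson abs_le_D1)
  define b where "b A = (\<Sum>i\<in>UNIV. spread (\<lambda>x :: real ^ 'n. v i (x $ i)) A)" for A
  have b0: "0 \<le> b A" for A unfolding b_def by (intro sum_nonneg spread_nonneg bdd)
  \<comment> \<open>Boundedness of \<open>g\<close>, which makes its logistic loss
    integrable.\<close>
  have range: "\<bar>g x\<bar> \<le> \<bar>g 0\<bar> + V" for x
  proof -
    have "(\<Sum>i\<in>UNIV. \<bar>v i (x $ i) - v i (y $ i)\<bar>) \<le> V" for x y
      unfolding V_def
    proof (rule sum_mono)
      fix i show "\<bar>v i (x $ i) - v i (y $ i)\<bar> \<le> total_variation (G i)"
        using v(2,3)[of i "x $ i"] v(2,3)[of i "y $ i"] by linarith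
    qed
    from this[of x 0] this[of 0 x] show ?thesis using sub[of x 0] sub[of 0 x] by linarith
  qed
  have g_borel: "g \<in> borel_measurable borel"
  proof -
    have "(\<lambda>x :: real ^ 'n. G i (x $ i)) \<in> borel_measurable borel" for i
      using bounded_variation_borel[OF bv[of i]] by measurable
    then show ?thesis unfolding g by (intro borel_measurable_sum)
  qed
  have "risk k \<le> (\<integral>\<omega>. ln (1 + exp (- Y \<omega> * g (X \<omega>))) \<partial>M) + (\<Sum>A\<in>P k. impurity A / 2 * b A)"
    unfolding log_odds_process_def
  proof (rule excess_risk[OF finite_P borel_P partition_P g_borel range _ b0])
    fix A and x y :: "real ^ 'n" assume xy: "x \<in> A" "y \<in> A"
    have "(\<Sum>i\<in>UNIV. \<bar>v i (x $ i) - v i (y $ i)\<bar>) \<le> b A"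
      unfolding b_def
    proof (rule sum_mono)
      fix i show "\<bar>v i (x $ i) - v i (y $ i)\<bar> \<le> spread (\<lambda>x. v i (x $ i)) A"
        using spread_ge[OF xy bdd[of i]] spread_ge[OF xy(2,1) bdd[of i]] by linarith
    qed
    then show "g x - g y \<le> b A" using sub[of x y] by linarith
  qed
  also have "(\<Sum>A\<in>P k. impurity A / 2 * b A) \<le> (\<Sum>A\<in>P k. H / 2 * b A)"
  proof (intro sum_mono mult_right_mono divide_right_mono b0)
    fix A assume "A \<in> P k"
    have "ln (exp 1 * N) / N = 1 / N * (1 - ln (1 / N))" using N(2) by (simp add: ln_mult_pos ln_div)
    then show "impurity A \<le> H"
      unfolding H_def using impurity_P_le[OF fin N(1) _ _ \<open>A \<in> P k\<close>] N(2) by simp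
  qed simp
  also have "\<dots> = H / 2 * (\<Sum>i\<in>UNIV. \<Sum>A\<in>P k. spread (\<lambda>x. v i (x $ i)) A)"
    unfolding b_def sum_distrib_left[symmetric] by (subst sum.swap) simp
  also have "\<dots> \<le> H / 2 * (\<Sum>i\<in>UNIV. total_variation (G i) * 2 ^ k / 2 ^ (k div CARD('n)))"
  proof (intro mult_left_mono sum_mono)
    fix i
    have "(\<Sum>A\<in>P k. spread (\<lambda>x. v i (x $ i)) A) \<le>
      total_variation (G i) * 2 ^ k / 2 ^ card {l. l < k \<and> split_axis l = i}"
      using v by (intro sum_spread_P_le) auto
    also have "\<dots> \<le> total_variation (G i) * 2 ^ k / 2 ^ (k div CARD('n))"
      using TV[of i] card_axis_ge[of k i] by (intro divide_left_mono power_increasing) auto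
    finally show "(\<Sum>A\<in>P k. spread (\<lambda>x. v i (x $ i)) A) \<le> total_variation (G i) * 2 ^ k / 2 ^ (k div CARD('n))" .
  next
    have "0 \<le> ln (exp 1 * N)" using N(2) by (simp add: ln_mult_pos)
    then show "0 \<le> H / 2" using N(2) by (simp add: H_def)
  qed
  also have "\<dots> = (H / 2 * 2 ^ k) / 2 ^ (k div CARD('n)) * V"
    unfolding V_def by (simp add: sum_distrib_right sum_distrib_left sum_divide_distrib mult_ac)
  also have "H / 2 * 2 ^ k = ln 2 / 2 + 2 ^ k * ln (exp 1 * N) / N"
    by (simp add: H_def field_simps)
  finally show ?thesis by (simp add: V_def)
qed

end

section \<open>Passage to the infimum over representations and functions\<close>

theorem theorem13:
  fixes M :: "'a measure"
    and X :: "'a \<Rightarrow> real ^ 'n::finite"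
    and Y :: "'a \<Rightarrow> real"
    and coord :: "nat \<Rightarrow> 'n"
    and P :: "nat \<Rightarrow> (real ^ 'n) set set"
    and N :: real
    and k :: nat
  assumes "prob_space M"
    and "X \<in> borel_measurable M"
    and "Y \<in> borel_measurable M"
    and "\<forall>\<omega> \<in> space M. Y \<omega> \<in> {-1, 1}"
    and "\<exists>S. finite S \<and> (AE \<omega> in M. X \<omega> \<in> S)"
    and "N \<ge> 1"
    and "\<forall>j u. \<P>(\<omega> in M. X \<omega> $ j = u) \<le> 1 / N"
    and "bij_betw coord {1..CARD('n)} UNIV"
    and "cyclic_minimax_split M X Y coord P"
  shows "(\<integral>\<omega>. logistic_loss (Y \<omega>) (log_odds_process M X Y P k \<omega>) \<partial>M)
    \<le> 2 powr (- real (k div CARD('n)) / 2) * (2 ^ k * ln (exp 1 * N) / N)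
      + (INF g \<in> additive_bv.
           (\<integral>\<omega>. ln (1 + exp (- Y \<omega> * g (X \<omega>))) \<partial>M)
           + sqrt (ln 2 / 4) * 2 powr (- real (k div CARD('n)) / 2)
               * (sqrt (tv_norm g) + tv_norm g / 2))"
proof -
  interpret prob_space M by fact
  interpret minimax_run M X Y coord P
    using assms by unfold_locales auto
  define m where "m = k div CARD('n)"
  define u :: real where "u = 2 powr (- real m / 2)"
  define D where "D = 2 ^ k * ln (exp 1 * N) / N"
  have "u\<^sup>2 = 2 powr (- real m)"
    unfolding u_def power2_eq_square by (simp flip: powr_add)
  then have u2: "u\<^sup>2 = 1 / 2 ^ m"
    by (simp add: powr_minus_divide powr_realpow)
  have u: "0 < u" "u \<le> 1" using powr_mono[of "- real m / 2" 0 2] by (auto simp: u_def)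
  have "0 \<le> ln (exp 1 * N)" using assms(6) by (simp add: ln_mult_pos)
  then have D: "0 \<le> D" using assms(6) by (simp add: D_def)
  let ?L = "\<lambda>g. \<integral>\<omega>. ln (1 + exp (- Y \<omega> * g (X \<omega>))) \<partial>M"
  have "risk k - u * D \<le> (INF g \<in> additive_bv. ?L g + sqrt (ln 2 / 4) * u * (sqrt (tv_norm g) + tv_norm g / 2))"
  proof (rule cINF_greatest)
    have "(\<lambda>_ _. 0) \<in> additive_reps (\<lambda>_ :: real ^ 'n. 0)"
      by (auto simp: additive_reps_def bounded_variation_def variation_sums_def)
    then show "(additive_bv :: (real ^ 'n \<Rightarrow> real) set) \<noteq> {}" by (auto simp: additive_bv_def)
  next
    fix g :: "real ^ 'n \<Rightarrow> real" assume "g \<in> additive_bv"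
    then have ne: "additive_reps g \<noteq> {}" by (simp add: additive_bv_def)
    have "0 \<le> ?L g"
      by (intro integral_nonneg_AE AE_I2 ln_ge_zero) simp
    then have 1: "risk k - ?L g \<le> ln 2" using risk_le_ln_2[of k] by linarith
    define C where "C = (ln 2 / 2 + D) * u\<^sup>2"
    have C: "0 < C" unfolding C_def using D u by (intro mult_pos_pos add_pos_nonneg) auto
    have tv: "0 \<le> total_variation (G i)" if "G \<in> additive_reps g" for G i
    proof -
      have "bounded_variation (G i)" using that by (simp add: additive_reps_def)
      from bounded_variation_dominating_mono[OF this] show ?thesis by (metis order_trans)
    qed
    \<comment> \<open>The infimum in \<open>tv_norm\<close> may not be attained. As the bound is
      linear in the variation, division by \<open>C > 0\<close> carries it over to the infimum; only
      then is the nonlinear estimate \<open>risk_bound_arith\<close> applied.\<close>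
    have "(risk k - ?L g) / C \<le> tv_norm g"
      unfolding tv_norm_def
    proof (rule cINF_greatest[OF ne])
      fix G assume "G \<in> additive_reps g"
      then have "risk k \<le> ?L g + C * (\<Sum>i\<in>UNIV. total_variation (G i))"
        using risk_le_additive[OF assms(5) _ assms(6), of G g k] assms(7)
        by (simp add: C_def u2 D_def m_def)
      then show "(risk k - ?L g) / C \<le> (\<Sum>i\<in>UNIV. total_variation (G i))"
        using C by (simp add: pos_divide_le_eq mult.commute)
    qed
    then have 2: "risk k - ?L g \<le> (ln 2 / 2 + D) * u\<^sup>2 * tv_norm g"
      using C by (simp add: pos_divide_le_eq mult.commute C_def)
    have "0 \<le> tv_norm g"
      unfolding tv_norm_def using tv by (intro cINF_greatest[OF ne] sum_nonneg)
    from risk_bound_arith[OF 1 2 u D this]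
    show "risk k - u * D \<le> ?L g + sqrt (ln 2 / 4) * u * (sqrt (tv_norm g) + tv_norm g / 2)" by simp
  qed
  then show ?thesis by (simp add: u_def D_def m_def algebra_simps)
qed

end
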